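(* Let $\mathcal{H}$ be a separable infinite dimensional complex Hilbert space and let $z\in\mathcal{B}(\mathcal{H})$ be a selfadjoint operator with finite spectrum $\sigma(z)=\{a_j\}_{j=-m}^{n+r}$ (with $m,n\ge 0$, $r\ge1$), listed in strictly increasing order, and let $p_j=\chi_{\{a_j\}}(z)$, so that $z=\sum_{j=-m}^{n+r}a_jp_j$. Assume that $a_0=0$, $a_{n+1}=1$, and $\operatorname{Tr}(p_j)<\infty$ for $j<0$ and for $j>n+1$. Let $\{e_k\}$ be an orthonormal basis of $\mathcal{H}$, let $d_k=\langle ze_k,e_k\rangle$, and put $$a=\sum_{d_k\le 1/2}d_k,\qquad b=\sum_{d_k>1/2}(1-d_k).$$ Let $q$ be the projection onto $\overline{\operatorname{span}}\{e_k\mid d_k>1/2\}$. If $a+b<\infty$, then $\operatorname{Tr}(p_j)<\infty$ for all $0<j<n+1$, $(p_{n+1},q)$ is a Fredholm pair, and $$a-b-\sum_{j\ne n+1}a_j\operatorname{Tr}(p_j)=[p_{n+1}:q].$$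
   Context: Projections are orthogonal projections. The convention $0\cdot\infty=0$ is used, so $a_0\operatorname{Tr}(p_0)=0$ even if $\operatorname{Tr}(p_0)=\infty$. The sums $a$ and $b$ are well defined in $(-\infty,\infty]$, since the negative parts of $z$ and of $1-z$ have finite rank and hence the negative terms are summable. A pair $(p,q)$ of projections is a Fredholm pair if $q|_{p\mathcal{H}}\in\mathcal{B}(p\mathcal{H},q\mathcal{H})$ is a Fredholm operator, and then $[p:q]:=\operatorname{ind}(q|_{p\mathcal{H}})$ (the essential codimension), where $\operatorname{ind}(x)=\dim\ker x-\dim\ker x^*$. *)

theory Defs
  imports "HOL-Analysis.Analysis" "HOL-Computational_Algebra.Polynomial"
begin

text \<open>
  A complex Hilbert space is given as a real Hilbert space with a compatible complex structure:
  the real inner product is the real part of the complex one, so the two norms (and hence the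
  topologies and operator norms) coincide. The complex inner product is linear in its
  \<^emph>\<open>first\<close> argument.
\<close>

class complex_hilbert_space = real_inner + complete_space +
  fixes scaleC :: "complex \<Rightarrow> 'a \<Rightarrow> 'a" (infixr \<open>*\<^sub>C\<close> 75)
    and cinner :: "'a \<Rightarrow> 'a \<Rightarrow> complex"
  assumes scaleC_add_right: "c *\<^sub>C (x + y) = c *\<^sub>C x + c *\<^sub>C y"
    and scaleC_add_left: "(c + d) *\<^sub>C x = c *\<^sub>C x + d *\<^sub>C x"
    and scaleC_scaleC: "c *\<^sub>C (d *\<^sub>C x) = (c * d) *\<^sub>C x"
    and scaleC_one: "1 *\<^sub>C x = x"
    and scaleR_scaleC: "r *\<^sub>R x = complex_of_real r *\<^sub>C x"
    and cinner_commute: "cinner x y = cnj (cinner y x)"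
    and cinner_add_left: "cinner (x + y) w = cinner x w + cinner y w"
    and cinner_scaleC_left: "cinner (c *\<^sub>C x) y = c * cinner x y"
    and Re_cinner: "Re (cinner x y) = inner x y"

global_interpretation cvec:
  vector_space "scaleC :: complex \<Rightarrow> 'a \<Rightarrow> 'a::complex_hilbert_space"
  by unfold_locales (simp_all add: scaleC_add_right scaleC_add_left scaleC_scaleC scaleC_one)

definition finite_cdim :: "'a::complex_hilbert_space set \<Rightarrow> bool" where
  "finite_cdim S \<longleftrightarrow> (\<exists>F. finite F \<and> S \<subseteq> cvec.span F)"

definition orthonormal_basis :: "(nat \<Rightarrow> 'a::complex_hilbert_space) \<Rightarrow> bool" where
  "orthonormal_basis e \<longleftrightarrow>
     (\<forall>i j. cinner (e i) (e j) = (if i = j then 1 else 0)) \<and>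
     closure (cvec.span (range e)) = UNIV"

subsection \<open>Bounded operators\<close>

definition bounded_clinear :: "('a::complex_hilbert_space \<Rightarrow> 'a) \<Rightarrow> bool" where
  "bounded_clinear T \<longleftrightarrow> bounded_linear T \<and> (\<forall>c x. T (c *\<^sub>C x) = c *\<^sub>C T x)"

definition selfadjoint :: "('a::complex_hilbert_space \<Rightarrow> 'a) \<Rightarrow> bool" where
  "selfadjoint T \<longleftrightarrow> bounded_clinear T \<and> (\<forall>x y. cinner (T x) y = cinner x (T y))"

definition projection :: "('a::complex_hilbert_space \<Rightarrow> 'a) \<Rightarrow> bool" where
  "projection p \<longleftrightarrow> selfadjoint p \<and> (\<forall>x. p (p x) = p x)"

text \<open>The projection onto a closed subspace.\<close>

definition proj_onto :: "'a::complex_hilbert_space set \<Rightarrow> 'a \<Rightarrow> 'a" where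
  "proj_onto S x = (THE y. y \<in> S \<and> (\<forall>s\<in>S. cinner (x - y) s = 0))"

definition spectrum :: "('a::complex_hilbert_space \<Rightarrow> 'a) \<Rightarrow> complex set" where
  "spectrum T = {c. \<not> (\<exists>R. bounded_clinear R \<and>
     (\<forall>x. R (T x - c *\<^sub>C x) = x) \<and> (\<forall>x. T (R x) - c *\<^sub>C R x = x))}"

text \<open>
  The trace of a positive operator, computed in some orthonormal basis (the value does not depend
  on which). It is meaningful in a separable infinite dimensional space, where bases are sequences.
\<close>

definition Tr :: "('a::complex_hilbert_space \<Rightarrow> 'a) \<Rightarrow> ennreal" where
  "Tr T = (let f = (SOME f :: nat \<Rightarrow> 'a. orthonormal_basis f)
              in \<Sum>k. ennreal (Re (cinner (T (f k)) (f k))))"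

subsection \<open>Functional calculus of a selfadjoint operator\<close>

definition poly_op :: "complex poly \<Rightarrow> ('a::complex_hilbert_space \<Rightarrow> 'a) \<Rightarrow> 'a \<Rightarrow> 'a" where
  "poly_op P T x = (\<Sum>i\<le>degree P. coeff P i *\<^sub>C (T ^^ i) x)"

text \<open>
  \<open>f(z)\<close> for selfadjoint \<open>z\<close> and \<open>f\<close> continuous on the spectrum of \<open>z\<close>: the norm limit
  of \<open>P\<^sub>n(z)\<close> for polynomials \<open>P\<^sub>n\<close> converging to \<open>f\<close> uniformly on the spectrum. When the spectrum
  is finite, every function on it is continuous, so the spectral projections \<open>\<chi>\<^bsub>{a}\<^esub>(z)\<close> are covered.
\<close>

definition func_calc ::
    "('a::complex_hilbert_space \<Rightarrow> 'a) \<Rightarrow> (complex \<Rightarrow> complex) \<Rightarrow> 'a \<Rightarrow> 'a" where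
  "func_calc z f = (THE T. bounded_clinear T \<and>
     (\<exists>P :: nat \<Rightarrow> complex poly.
        uniform_limit (spectrum z) (\<lambda>n. poly (P n)) f sequentially \<and>
        (\<lambda>n. onorm (\<lambda>x. poly_op (P n) z x - T x)) \<longlonglongrightarrow> 0))"

subsection \<open>Fredholm operators between closed subspaces\<close>

text \<open>
  The predicate \<open>bounded_op V W T\<close> says that \<open>V\<close> and \<open>W\<close> are closed subspaces and that \<open>T\<close>,
  restricted to \<open>V\<close>, is a bounded operator from \<open>V\<close> to \<open>W\<close>. In the definitions below only the
  values of \<open>T\<close> on \<open>V\<close> matter, and \<open>adjoint_on V W T\<close> is the adjoint, from \<open>W\<close> to \<open>V\<close>.
\<close>

definition bounded_op ::
    "'a::complex_hilbert_space set \<Rightarrow> 'a set \<Rightarrow> ('a \<Rightarrow> 'a) \<Rightarrow> bool" where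
  "bounded_op V W T \<longleftrightarrow>
     closed V \<and> cvec.subspace V \<and> closed W \<and> cvec.subspace W \<and>
     T ` V \<subseteq> W \<and>
     (\<forall>x\<in>V. \<forall>y\<in>V. T (x + y) = T x + T y) \<and>
     (\<forall>c. \<forall>x\<in>V. T (c *\<^sub>C x) = c *\<^sub>C T x) \<and>
     (\<exists>K. \<forall>x\<in>V. norm (T x) \<le> K * norm x)"

definition ker_on :: "'a::complex_hilbert_space set \<Rightarrow> ('a \<Rightarrow> 'a) \<Rightarrow> 'a set" where
  "ker_on V T = {x\<in>V. T x = 0}"

definition adjoint_on ::
    "'a::complex_hilbert_space set \<Rightarrow> 'a set \<Rightarrow> ('a \<Rightarrow> 'a) \<Rightarrow> 'a \<Rightarrow> 'a" where
  "adjoint_on V W T y = (THE u. u \<in> V \<and> (\<forall>x\<in>V. cinner (T x) y = cinner x u))"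

definition fredholm_on ::
    "'a::complex_hilbert_space set \<Rightarrow> 'a set \<Rightarrow> ('a \<Rightarrow> 'a) \<Rightarrow> bool" where
  "fredholm_on V W T \<longleftrightarrow>
     bounded_op V W T \<and> closed (T ` V) \<and>
     finite_cdim (ker_on V T) \<and> finite_cdim (ker_on W (adjoint_on V W T))"

definition fredholm_index ::
    "'a::complex_hilbert_space set \<Rightarrow> 'a set \<Rightarrow> ('a \<Rightarrow> 'a) \<Rightarrow> int" where
  "fredholm_index V W T =
     int (cvec.dim (ker_on V T)) - int (cvec.dim (ker_on W (adjoint_on V W T)))"

definition fredholm_pair ::
    "('a::complex_hilbert_space \<Rightarrow> 'a) \<Rightarrow> ('a \<Rightarrow> 'a) \<Rightarrow> bool" where
  "fredholm_pair p q \<longleftrightarrow> projection p \<and> projection q \<and> fredholm_on (range p) (range q) q"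

definition essential_codim ::
    "('a::complex_hilbert_space \<Rightarrow> 'a) \<Rightarrow> ('a \<Rightarrow> 'a) \<Rightarrow> int" where
  "essential_codim p q = fredholm_index (range p) (range q) q"

end

theory Submission
  imports Defs "HOL-Computational_Algebra.Fundamental_Theorem_Algebra"
begin

text \<open>
  Write \<open>x j k = \<parallel>p\<^sub>j e\<^sub>k\<parallel>\<^sup>2\<close>, so that \<open>d\<^sub>k = \<Sum>\<^sub>j a\<^sub>j x j k\<close>, \<open>\<Sum>\<^sub>j x j k = 1\<close> and
  \<open>Tr(p\<^sub>j) = \<Sum>\<^sub>k x j k\<close>. Let \<open>T\<close> be the set of the \<open>k\<close> with \<open>d\<^sub>k > 1/2\<close>, and let \<open>p\<close> be the
  spectral projection of the eigenvalue 1. As \<open>x j\<close> is summable when \<open>a\<^sub>j\<close> lies outside \<open>[0, 1]\<close>,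
  finiteness of \<open>A\<close> makes \<open>x j\<close> summable over the complement of \<open>T\<close> for \<open>a\<^sub>j \<noteq> 0\<close>, and finiteness of
  \<open>B\<close> makes it summable over \<open>T\<close> for \<open>a\<^sub>j \<noteq> 1\<close>. So \<open>Tr(p\<^sub>j) < \<infinity>\<close> for \<open>0 < a\<^sub>j < 1\<close>, and sorting
  the absolutely convergent sums (lemma \<open>diagonal_sums\<close>) turns \<open>A - B - \<Sum> a\<^sub>j Tr(p\<^sub>j)\<close> into the sum
  of \<open>\<parallel>p e\<^sub>k\<parallel>\<^sup>2\<close> over \<open>k \<notin> T\<close> minus the sum of \<open>\<parallel>(1 - p) e\<^sub>k\<parallel>\<^sup>2\<close> over \<open>k \<in> T\<close>. As \<open>q e\<^sub>k\<close> is
  \<open>e\<^sub>k\<close> for \<open>k \<in> T\<close> and \<open>0\<close> otherwise, these are the squared Hilbert-Schmidt norms of \<open>p (1 - q)\<close> and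
  \<open>(1 - p) q\<close>. In particular \<open>D = p - q\<close> is Hilbert-Schmidt.

  It remains to see that for projections with Hilbert-Schmidt difference, \<open>(p, q)\<close> is a Fredholm pair
  whose index is the difference of these two squared norms (lemmas \<open>fredholm\<close> and \<open>index_formula\<close>). The contraction
  \<open>K = D\<^sup>2 \<ge> 0\<close> commutes with \<open>p\<close> and \<open>q\<close>, and the two squared norms are \<open>tr(K p)\<close> and \<open>tr(K q)\<close>.
  Since \<open>p (1 - K) p = p q p\<close> and \<open>q (1 - K) q = q p q\<close>, cyclicity of the trace shows that
  \<open>tr(K\<^sup>n p) - tr(K\<^sup>n q)\<close> does not depend on \<open>n \<ge> 1\<close>. The powers of \<open>K\<close> decrease strongly to the
  projection \<open>L\<close> onto \<open>ker (1 - K)\<close>, so by dominated convergence the constant is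
  \<open>tr(L p) - tr(L q)\<close>. Here \<open>L p\<close> and \<open>L q\<close> are the projections onto \<open>ran p \<inter> ker q\<close> and
  \<open>ran q \<inter> ker p\<close>, which are the kernels of \<open>q : ran p \<rightarrow> ran q\<close> and of its adjoint. The
  same convergence in Hilbert-Schmidt norm bounds \<open>1 - K\<close> from below off \<open>ran L\<close>, whence the range is
  closed.

  Two facts link this to the definitions: a trace is independent of the basis
  (lemma \<open>Tr_projection\<close>), and the spectral projections given by the functional calculus of \<open>z\<close> are
  Lagrange interpolation polynomials in \<open>z\<close> (lemma \<open>spectral_decomposition\<close>).
\<close>

section \<open>Inner products, Parseval and Hilbert-Schmidt norms\<close>

lemma cinner_add_right: "cinner x (y + w) = cinner x y + cinner x w"
  by (metis cinner_add_left cinner_commute complex_cnj_add)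

lemma cinner_scaleC_right: "cinner x (c *\<^sub>C y) = cnj c * cinner x y"
  by (metis cinner_scaleC_left cinner_commute complex_cnj_mult)

lemma cinner_zero_left [simp]: "cinner 0 y = 0"
  using cinner_add_left[of 0 0 y] by simp

lemma cinner_zero_right [simp]: "cinner y 0 = 0"
  using cinner_add_right[of y 0 0] by simp

lemma cinner_minus_left: "cinner (- x) y = - cinner x y"
  using cinner_add_left[of x "- x" y] by (simp add: eq_neg_iff_add_eq_0 add.commute)

lemma cinner_minus_right: "cinner x (- y) = - cinner x y"
  using cinner_add_right[of x y "- y"] by (simp add: eq_neg_iff_add_eq_0 add.commute)

lemma cinner_diff_left: "cinner (x - y) w = cinner x w - cinner y w"
  using cinner_add_left[of x "- y" w] by (simp add: cinner_minus_left)

lemma cinner_diff_right: "cinner x (y - w) = cinner x y - cinner x w"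
  using cinner_add_right[of x y "- w"] by (simp add: cinner_minus_right)

lemma cinner_sum_left: "cinner (\<Sum>i\<in>I. f i) y = (\<Sum>i\<in>I. cinner (f i) y)"
  by (induction I rule: infinite_finite_induct) (auto simp: cinner_add_left)

lemma cinner_sum_right: "cinner y (\<Sum>i\<in>I. f i) = (\<Sum>i\<in>I. cinner y (f i))"
  by (induction I rule: infinite_finite_induct) (auto simp: cinner_add_right)

lemma cinner_self: "cinner x x = complex_of_real ((norm x)\<^sup>2)"
proof -
  have "Im (cinner x x) = 0"
    using cinner_commute[of x x] by (metis add_0 add_diff_cancel_right' cnj.simps(2) eq_neg_iff_add_eq_0 mult_2 mult_eq_0_iff zero_neq_numeral)
  then show ?thesis
    by (simp add: complex_eq_iff Re_cinner power2_norm_eq_inner)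
qed

lemma norm_scaleC: "norm (c *\<^sub>C x) = cmod c * norm x"
proof -
  have "complex_of_real ((norm (c *\<^sub>C x))\<^sup>2) = complex_of_real ((cmod c * norm x)\<^sup>2)"
    unfolding cinner_self[symmetric] cinner_scaleC_left cinner_scaleC_right
    by (simp add: cinner_self power_mult_distrib complex_norm_square del: of_real_power)
  then show ?thesis
    by (metis norm_ge_zero of_real_eq_iff power2_eq_iff_nonneg zero_le_mult_iff)
qed

lemma cmod_cinner_le: "cmod (cinner x y) \<le> norm x * norm y"
proof (cases "cinner x y = 0")
  case False
  define c where "c = cnj (sgn (cinner x y))"
  have "cinner (c *\<^sub>C x) y = complex_of_real (cmod (cinner x y))"
    using False unfolding c_def cinner_scaleC_left sgn_eq
    by (simp add: field_simps power2_eq_square flip: complex_norm_square)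
  then have "cmod (cinner x y) = inner (c *\<^sub>C x) y"
    by (metis Re_cinner Re_complex_of_real)
  also have "\<dots> \<le> norm (c *\<^sub>C x) * norm y"
    by (rule norm_cauchy_schwarz)
  also have "\<dots> = norm x * norm y"
    using False by (simp add: norm_scaleC c_def norm_sgn)
  finally show ?thesis .
qed simp

lemma bounded_linear_cinner_left: "bounded_linear (\<lambda>x. cinner x y)"
  by (rule bounded_linear_intro[where K = "norm y"])
     (auto simp: cinner_add_left scaleR_scaleC cinner_scaleC_left scaleR_conv_of_real cmod_cinner_le)

lemma bounded_linear_scaleC: "bounded_linear (\<lambda>x :: 'a::complex_hilbert_space. c *\<^sub>C x)"
  by (rule bounded_linear_intro[where K = "cmod c"])
     (auto simp: scaleC_add_right scaleR_scaleC scaleC_scaleC norm_scaleC mult.commute)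

lemma bounded_linear_scaleC_left: "bounded_linear (\<lambda>c. c *\<^sub>C (x :: 'a::complex_hilbert_space))"
  by (rule bounded_linear_intro[where K = "norm x"])
     (auto simp: scaleC_add_left scaleR_scaleC scaleC_scaleC norm_scaleC scaleR_conv_of_real)

lemma closure_subspace:
  assumes "cvec.subspace S" shows "cvec.subspace (closure S)"
proof (rule cvec.subspaceI)
  show "0 \<in> closure S"
    using assms closure_subset cvec.subspace_0 by blast
next
  fix x y assume "x \<in> closure S" "y \<in> closure S"
  then obtain f g where "\<And>n. f n \<in> S" "f \<longlonglongrightarrow> x" "\<And>n. g n \<in> S" "g \<longlonglongrightarrow> y"
    unfolding closure_sequential by blast
  then show "x + y \<in> closure S"
    unfolding closure_sequential
    by (intro exI[of _ "\<lambda>n. f n + g n"]) (auto intro!: tendsto_add cvec.subspace_add[OF assms])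
next
  fix c x assume "x \<in> closure S"
  then obtain f where "\<And>n. f n \<in> S" "f \<longlonglongrightarrow> x"
    unfolding closure_sequential by blast
  then show "c *\<^sub>C x \<in> closure S"
    unfolding closure_sequential
    by (intro exI[of _ "\<lambda>n. c *\<^sub>C f n"])
       (auto intro!: bounded_linear.tendsto[OF bounded_linear_scaleC] cvec.subspace_scale[OF assms])
qed

lemma closed_cinner_zero: "closed {x. cinner x y = 0}"
  by (intro closed_Collect_eq bounded_linear.continuous_on[OF bounded_linear_cinner_left] continuous_intros)

lemma subspace_cinner_zero: "cvec.subspace {x. cinner x y = 0}"
  by (rule cvec.subspaceI) (auto simp: cinner_add_left cinner_scaleC_left)

lemma cinner_closure_span_eq_0:
  assumes "x \<in> closure (cvec.span S)" "\<And>s. s \<in> S \<Longrightarrow> cinner s y = 0"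
  shows "cinner x y = 0"
proof -
  have "cvec.span S \<subseteq> {x. cinner x y = 0}"
    using assms(2) by (intro cvec.span_minimal subspace_cinner_zero) auto
  then show ?thesis
    using assms(1) closure_minimal[OF _ closed_cinner_zero] by blast
qed

lemma orthonormal_basisD:
  assumes "orthonormal_basis e"
  shows "cinner (e i) (e j) = (if i = j then 1 else 0)"
    and "x \<in> closure (cvec.span (range e))"
  using assms by (auto simp: orthonormal_basis_def)

lemma orthonormal_fourier_sum:
  fixes e :: "'i \<Rightarrow> 'a::complex_hilbert_space"
  assumes I: "finite I" and on: "\<And>i j. i \<in> I \<Longrightarrow> j \<in> I \<Longrightarrow> cinner (e i) (e j) = (if i = j then 1 else 0)"
  defines "s \<equiv> \<lambda>x. \<Sum>k\<in>I. cinner x (e k) *\<^sub>C e k"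
  shows "\<And>k. k \<in> I \<Longrightarrow> cinner (x - s x) (e k) = 0"
    and "(\<Sum>k\<in>I. (cmod (cinner x (e k)))\<^sup>2) = (norm x)\<^sup>2 - (norm (x - s x))\<^sup>2"
proof -
  show orth: "cinner (x - s x) (e k) = 0" if "k \<in> I" for k
  proof -
    have "(\<Sum>i\<in>I. cinner x (e i) * cinner (e i) (e k)) = (\<Sum>i\<in>I. if k = i then cinner x (e i) else 0)"
      using that by (intro sum.cong) (auto simp: on)
    then show ?thesis
      using that I by (simp add: s_def cinner_diff_left cinner_sum_left cinner_scaleC_left)
  qed
  have cinner_s: "cinner w (s x) = (\<Sum>k\<in>I. cnj (cinner x (e k)) * cinner w (e k))" for w
    by (simp add: s_def cinner_sum_right cinner_scaleC_right)
  have "cinner (x - s x) (s x) = 0"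
    unfolding cinner_s using orth by simp
  then have "inner (x - s x) (s x) = 0"
    by (simp flip: Re_cinner)
  then have 1: "(norm x)\<^sup>2 = (norm (x - s x))\<^sup>2 + inner x (s x)"
    by (simp add: power2_norm_eq_inner inner_diff_left inner_diff_right inner_commute)
  have "cinner x (s x) = complex_of_real (\<Sum>k\<in>I. (cmod (cinner x (e k)))\<^sup>2)"
    unfolding cinner_s
    by (simp add: complex_norm_square mult.commute del: of_real_power)
  then have "inner x (s x) = (\<Sum>k\<in>I. (cmod (cinner x (e k)))\<^sup>2)"
    by (simp flip: Re_cinner)
  then show "(\<Sum>k\<in>I. (cmod (cinner x (e k)))\<^sup>2) = (norm x)\<^sup>2 - (norm (x - s x))\<^sup>2"
    using 1 by simp
qed

text \<open>
  Parseval's identity: a vector of the span within distance \<open>\<epsilon>\<close> of \<open>x\<close> lies in the span of the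
  first \<open>N\<close> basis vectors, and the partial Fourier sum of order \<open>n \<ge> N\<close> is at least as close to \<open>x\<close>.
\<close>

lemma parseval:
  assumes e: "orthonormal_basis e"
  shows "(\<lambda>k. (cmod (cinner x (e k)))\<^sup>2) sums (norm x)\<^sup>2"
proof -
  define s where "s n = (\<Sum>k<n. cinner x (e k) *\<^sub>C e k)" for n
  have fourier: "k < n \<Longrightarrow> cinner (x - s n) (e k) = 0"
      "(\<Sum>k<n. (cmod (cinner x (e k)))\<^sup>2) = (norm x)\<^sup>2 - (norm (x - s n))\<^sup>2" for k n
    using orthonormal_fourier_sum[where I = "{..<n}" and e = e and x = x] orthonormal_basisD(1)[OF e]
    unfolding s_def by auto
  have "s \<longlonglongrightarrow> x"
  proof (rule LIMSEQ_I)
    fix \<epsilon> :: real assume "\<epsilon> > 0"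
    then obtain y where y: "y \<in> cvec.span (range e)" "dist y x < \<epsilon>"
      using orthonormal_basisD(2)[OF e, of x] unfolding closure_approachable by blast
    obtain T where T: "finite T" "T \<subseteq> range e" "y \<in> cvec.span T"
    proof -
      from y(1) obtain t c where t: "finite t" "t \<subseteq> range e" "y = (\<Sum>v\<in>t. c v *\<^sub>C v)"
        unfolding cvec.span_explicit by blast
      have "y \<in> cvec.span t"
        unfolding t(3) by (intro cvec.span_sum cvec.span_scale cvec.span_base)
      then show ?thesis using t that by blast
    qed
    then obtain I where I: "finite I" "T = e ` I"
      by (meson finite_subset_image)
    then obtain N where N: "I \<subseteq> {..<N}"
      using finite_nat_bounded by blast
    have "norm (s n - x) < \<epsilon>" if "n \<ge> N" for n
    proof -
      have "cinner w (x - s n) = 0" if "w \<in> cvec.span (e ` {..<n})" for w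
      proof (rule cinner_closure_span_eq_0[of _ "e ` {..<n}"])
        show "w \<in> closure (cvec.span (e ` {..<n}))"
          using that closure_subset by blast
        show "\<And>s'. s' \<in> e ` {..<n} \<Longrightarrow> cinner s' (x - s n) = 0"
          using fourier(1) cinner_commute by (metis complex_cnj_zero imageE lessThan_iff)
      qed
      moreover have "y - s n \<in> cvec.span (e ` {..<n})"
      proof (rule cvec.span_diff)
        have "T \<subseteq> e ` {..<n}"
          using I(2) N \<open>n \<ge> N\<close> by auto
        then show "y \<in> cvec.span (e ` {..<n})"
          using T(3) cvec.span_mono by blast
        show "s n \<in> cvec.span (e ` {..<n})"
          unfolding s_def by (intro cvec.span_sum cvec.span_scale cvec.span_base) auto
      qed
      ultimately have "inner (y - s n) (x - s n) = 0"
        by (simp flip: Re_cinner)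
      then have "(norm (y - x))\<^sup>2 = (norm (y - s n))\<^sup>2 + (norm (s n - x))\<^sup>2"
        by (simp add: power2_norm_eq_inner inner_diff_left inner_diff_right inner_commute)
      then have "norm (s n - x) \<le> norm (y - x)"
        by (metis le_add_same_cancel2 norm_ge_zero power2_le_imp_le zero_le_power2)
      then show ?thesis
        using y(2) by (simp add: dist_norm)
    qed
    then show "\<exists>N. \<forall>n\<ge>N. norm (s n - x) < \<epsilon>" by blast
  qed
  then have "(\<lambda>n. (norm x)\<^sup>2 - (norm (x - s n))\<^sup>2) \<longlonglongrightarrow> (norm x)\<^sup>2 - (norm (x - x))\<^sup>2"
    by (intro tendsto_intros)
  then show ?thesis
    unfolding sums_def fourier(2) by simp
qed

lemma parseval_ennreal:
  assumes "orthonormal_basis e"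
  shows "ennreal ((norm x)\<^sup>2) = (\<Sum>k. ennreal ((cmod (cinner x (e k)))\<^sup>2))"
  by (rule suminf_ennreal_eq[OF _ parseval[OF assms], symmetric]) simp

lemma suminf_swap_ennreal:
  fixes f :: "nat \<Rightarrow> nat \<Rightarrow> ennreal"
  shows "(\<Sum>i. \<Sum>j. f i j) = (\<Sum>j. \<Sum>i. f i j)"
proof -
  have "(\<integral>\<^sup>+i. (\<Sum>j. f i j) \<partial>count_space UNIV) = (\<Sum>j. \<integral>\<^sup>+i. f i j \<partial>count_space UNIV)"
    by (rule nn_integral_suminf) simp
  then show ?thesis
    unfolding nn_integral_count_space_nat .
qed

text \<open>
  The Hilbert-Schmidt norm of an operator equals that of its adjoint, whatever the bases: both are
  the sum of the squared moduli of all matrix coefficients. Taking for \<open>A\<close> a projection, this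
  is the independence of its trace from the basis.
\<close>

lemma hilbert_schmidt_adjoint_ennreal:
  fixes A B :: "'a::complex_hilbert_space \<Rightarrow> 'a"
  assumes e: "orthonormal_basis e" and f: "orthonormal_basis f"
    and adj: "\<And>x y. cinner (A x) y = cinner x (B y)"
  shows "(\<Sum>k. ennreal ((norm (A (e k)))\<^sup>2)) = (\<Sum>k. ennreal ((norm (B (f k)))\<^sup>2))"
proof -
  have "(\<Sum>k. ennreal ((norm (A (e k)))\<^sup>2)) = (\<Sum>k. \<Sum>l. ennreal ((cmod (cinner (A (e k)) (f l)))\<^sup>2))"
    by (intro suminf_cong parseval_ennreal[OF f])
  also have "\<dots> = (\<Sum>l. \<Sum>k. ennreal ((cmod (cinner (A (e k)) (f l)))\<^sup>2))"
    by (rule suminf_swap_ennreal)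
  also have "\<dots> = (\<Sum>l. \<Sum>k. ennreal ((cmod (cinner (B (f l)) (e k)))\<^sup>2))"
  proof -
    have "cmod (cinner (A x) y) = cmod (cinner (B y) x)" for x y
      unfolding adj by (subst cinner_commute) simp
    then show ?thesis by simp
  qed
  also have "\<dots> = (\<Sum>k. ennreal ((norm (B (f k)))\<^sup>2))"
    by (intro suminf_cong parseval_ennreal[OF e, symmetric])
  finally show ?thesis .
qed

lemma hilbert_schmidt_adjoint:
  fixes A B :: "'a::complex_hilbert_space \<Rightarrow> 'a"
  assumes e: "orthonormal_basis e"
    and adj: "\<And>x y. cinner (A x) y = cinner x (B y)"
    and sm: "summable (\<lambda>k. (norm (A (e k)))\<^sup>2)"
  shows "summable (\<lambda>k. (norm (B (e k)))\<^sup>2)"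
    and "(\<Sum>k. (norm (A (e k)))\<^sup>2) = (\<Sum>k. (norm (B (e k)))\<^sup>2)"
proof -
  have eq: "(\<Sum>k. ennreal ((norm (A (e k)))\<^sup>2)) = (\<Sum>k. ennreal ((norm (B (e k)))\<^sup>2))"
    by (rule hilbert_schmidt_adjoint_ennreal[OF e e]) (rule adj)
  have A: "(\<Sum>k. ennreal ((norm (A (e k)))\<^sup>2)) = ennreal (\<Sum>k. (norm (A (e k)))\<^sup>2)"
    using sm by (intro suminf_ennreal2) auto
  then have "(\<Sum>k. ennreal ((norm (B (e k)))\<^sup>2)) \<noteq> top"
    unfolding eq by simp
  then show sB: "summable (\<lambda>k. (norm (B (e k)))\<^sup>2)"
    by (intro summable_suminf_not_top) auto
  have "ennreal (\<Sum>k. (norm (A (e k)))\<^sup>2) = ennreal (\<Sum>k. (norm (B (e k)))\<^sup>2)"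
    unfolding A[symmetric] eq by (intro suminf_ennreal2 sB) auto
  then show "(\<Sum>k. (norm (A (e k)))\<^sup>2) = (\<Sum>k. (norm (B (e k)))\<^sup>2)"
    using sm sB by (simp add: suminf_nonneg)
qed

section \<open>Selfadjoint operators with finite spectrum\<close>

lemma bounded_clinearD:
  assumes "bounded_clinear T"
  shows "bounded_linear T" "T (c *\<^sub>C x) = c *\<^sub>C T x" "T (x + y) = T x + T y"
    "T (x - y) = T x - T y" "T 0 = 0" "T (- x) = - T x" "T (r *\<^sub>R x) = r *\<^sub>R T x"
    "T (\<Sum>i\<in>I. f i) = (\<Sum>i\<in>I. T (f i))"
proof -
  show bl: "bounded_linear T" and "T (c *\<^sub>C x) = c *\<^sub>C T x"
    using assms by (auto simp: bounded_clinear_def)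
  interpret bounded_linear T by (fact bl)
  show "T (x + y) = T x + T y" "T (x - y) = T x - T y" "T 0 = 0" "T (- x) = - T x"
    "T (r *\<^sub>R x) = r *\<^sub>R T x" "T (\<Sum>i\<in>I. f i) = (\<Sum>i\<in>I. T (f i))"
    by (simp_all add: add diff zero neg scaleR sum)
qed

lemma bounded_clinear_ident: "bounded_clinear (\<lambda>x. x)"
  by (simp add: bounded_clinear_def bounded_linear_ident)

lemma bounded_clinear_zero: "bounded_clinear (\<lambda>x. 0)"
  by (simp add: bounded_clinear_def)

lemma bounded_clinear_add:
  "bounded_clinear S \<Longrightarrow> bounded_clinear T \<Longrightarrow> bounded_clinear (\<lambda>x. S x + T x)"
  by (simp add: bounded_clinear_def bounded_linear_add scaleC_add_right)

lemma bounded_clinear_diff: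
  "bounded_clinear S \<Longrightarrow> bounded_clinear T \<Longrightarrow> bounded_clinear (\<lambda>x. S x - T x)"
  by (simp add: bounded_clinear_def bounded_linear_sub cvec.scale_right_diff_distrib)

lemma bounded_clinear_scaleC:
  "bounded_clinear T \<Longrightarrow> bounded_clinear (\<lambda>x. c *\<^sub>C T x)"
  by (auto simp: bounded_clinear_def scaleC_scaleC mult.commute
      intro: bounded_linear_compose[OF bounded_linear_scaleC])

lemma bounded_clinear_compose:
  "bounded_clinear S \<Longrightarrow> bounded_clinear T \<Longrightarrow> bounded_clinear (\<lambda>x. S (T x))"
  by (auto simp: bounded_clinear_def intro: bounded_linear_compose)

lemma selfadjointD:
  assumes "selfadjoint T"
  shows "bounded_clinear T" "cinner (T x) y = cinner x (T y)" "inner (T x) y = inner x (T y)"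
  using assms by (auto simp: selfadjoint_def simp flip: Re_cinner)

lemma poly_op_eq_sum:
  assumes "degree P \<le> N"
  shows "poly_op P T x = (\<Sum>i\<le>N. coeff P i *\<^sub>C (T ^^ i) x)"
  unfolding poly_op_def using assms
  by (intro sum.mono_neutral_left) (auto simp: coeff_eq_0 not_le)

lemma poly_op_0 [simp]: "poly_op 0 T x = 0"
  by (simp add: poly_op_def)

lemma poly_op_pCons:
  assumes "bounded_clinear T"
  shows "poly_op (pCons c P) T x = c *\<^sub>C x + T (poly_op P T x)"
proof -
  have "poly_op (pCons c P) T x = (\<Sum>i\<le>Suc (degree P). coeff (pCons c P) i *\<^sub>C (T ^^ i) x)"
    by (intro poly_op_eq_sum degree_pCons_le)
  also have "\<dots> = c *\<^sub>C x + (\<Sum>i\<le>degree P. coeff P i *\<^sub>C (T ^^ Suc i) x)"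
    by (subst sum.atMost_Suc_shift) simp
  also have "(\<Sum>i\<le>degree P. coeff P i *\<^sub>C (T ^^ Suc i) x) = T (poly_op P T x)"
    unfolding poly_op_def bounded_clinearD(8)[OF assms] bounded_clinearD(2)[OF assms] by simp
  finally show ?thesis .
qed

lemma poly_op_const: "bounded_clinear T \<Longrightarrow> poly_op [:c:] T x = c *\<^sub>C x"
  by (simp add: poly_op_pCons bounded_clinearD(5))

lemma poly_op_linear_poly: "bounded_clinear T \<Longrightarrow> poly_op [:c, d:] T x = c *\<^sub>C x + d *\<^sub>C T x"
  by (simp add: poly_op_pCons bounded_clinearD)

lemma poly_op_add: "poly_op (P + Q) T x = poly_op P T x + poly_op Q T x"
proof -
  let ?N = "max (degree P) (degree Q)"
  show ?thesis
    using poly_op_eq_sum[of "P + Q" ?N T x] poly_op_eq_sum[of P ?N T x] poly_op_eq_sum[of Q ?N T x]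
    by (simp add: degree_add_le scaleC_add_left sum.distrib)
qed

lemma poly_op_smult: "poly_op (smult c P) T x = c *\<^sub>C poly_op P T x"
  using poly_op_eq_sum[of "smult c P" "degree P" T x] poly_op_eq_sum[of P "degree P" T x]
  by (simp add: degree_smult_le cvec.scale_sum_right scaleC_scaleC)

lemma poly_op_diff: "poly_op (P - Q) T x = poly_op P T x - poly_op Q T x"
  using poly_op_add[of "P - Q" Q T x] by simp

lemma poly_op_sum: "poly_op (\<Sum>i\<in>I. P i) T x = (\<Sum>i\<in>I. poly_op (P i) T x)"
  by (induction I rule: infinite_finite_induct) (auto simp: poly_op_add)

lemma bounded_clinear_poly_op:
  assumes "bounded_clinear T" shows "bounded_clinear (poly_op P T)"
proof (induction P)
  case 0
  then show ?case using bounded_clinear_zero by (simp add: poly_op_def)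
next
  case (pCons c P)
  then show ?case
    using bounded_clinear_add[OF bounded_clinear_scaleC[OF bounded_clinear_ident]
        bounded_clinear_compose[OF assms pCons(2)], of c]
    by (simp add: poly_op_pCons[OF assms] flip: fun_eq_iff) 
qed

lemma poly_op_mult:
  assumes "bounded_clinear T"
  shows "poly_op (P * Q) T x = poly_op P T (poly_op Q T x)"
proof (induction P)
  case (pCons c P)
  then show ?case
    by (simp add: poly_op_add poly_op_smult poly_op_pCons[OF assms])
qed simp

text \<open>
  Over the complex numbers \<open>Q\<close> splits, so that \<open>Q(T)\<close> is a product of invertible operators
  \<open>T - \<mu>\<close> when no root \<open>\<mu>\<close> of \<open>Q\<close> lies in the spectrum. This is one inclusion of the spectral
  mapping theorem: if \<open>0\<close> is not a value of \<open>Q\<close> on the spectrum, \<open>Q(T)\<close> is bounded below.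
\<close>

lemma poly_op_bounded_below:
  fixes T :: "'a::complex_hilbert_space \<Rightarrow> 'a"
  assumes T: "bounded_clinear T"
  shows "Q \<noteq> 0 \<Longrightarrow> (\<And>\<mu>. poly Q \<mu> = 0 \<Longrightarrow> \<mu> \<notin> spectrum T) \<Longrightarrow>
    \<exists>C>0. \<forall>x. norm x \<le> C * norm (poly_op Q T x)"
proof (induction "degree Q" arbitrary: Q)
  case 0
  then obtain c where c: "Q = [:c:]" "c \<noteq> 0"
    by (metis degree_eq_zeroE pCons_eq_0_iff)
  then show ?case
    by (intro exI[of _ "1 / cmod c"]) (auto simp: poly_op_const[OF T] norm_scaleC)
next
  case (Suc n)
  then have "\<not> constant (poly Q)"
    by (simp add: constant_degree)
  then obtain \<mu> where \<mu>: "poly Q \<mu> = 0"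
    using fundamental_theorem_of_algebra by blast
  then obtain Q' where Q': "Q = [:- \<mu>, 1:] * Q'"
    by (metis dvdE poly_eq_0_iff_dvd)
  have "Q' \<noteq> 0" using Q' Suc.prems by auto
  moreover have "n = degree Q'"
    using Suc.hyps(2) \<open>Q' \<noteq> 0\<close> unfolding Q' by (subst (asm) degree_mult_eq) auto
  moreover have "\<And>\<mu>. poly Q' \<mu> = 0 \<Longrightarrow> \<mu> \<notin> spectrum T"
    using Suc.prems(2) unfolding Q' by simp
  ultimately obtain C where C: "C > 0" "\<And>x. norm x \<le> C * norm (poly_op Q' T x)"
    using Suc.hyps(1) by blast
  obtain R where R: "bounded_clinear R" "\<And>x. R (T x - \<mu> *\<^sub>C x) = x"
    using Suc.prems(2)[OF \<mu>] unfolding spectrum_def by blast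
  obtain K where K: "K > 0" "\<And>x. norm (R x) \<le> norm x * K"
    using bounded_linear.pos_bounded[OF bounded_clinearD(1)[OF R(1)]] by blast
  have "norm x \<le> C * K * norm (poly_op Q T x)" for x
  proof -
    define y where "y = poly_op Q' T x"
    have Qx: "poly_op Q T x = T y - \<mu> *\<^sub>C y"
      unfolding Q' poly_op_mult[OF T] y_def by (simp add: poly_op_linear_poly[OF T] scaleC_one)
    have "norm x \<le> C * norm y"
      using C(2) y_def by blast
    also have "norm y \<le> norm (poly_op Q T x) * K"
      using K(2)[of "poly_op Q T x"] R(2)[of y] unfolding Qx by simp
    finally show ?thesis
      using C(1) by (simp add: mult_ac)
  qed
  then show ?case
    using C(1) K(1) by (intro exI[of _ "C * K"]) auto
qed

text \<open>
  For selfadjoint \<open>y\<close> of norm \<open>N\<close>, the operator \<open>y\<^sup>2 - N\<^sup>2\<close> is not bounded below, because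
  \<open>\<parallel>y\<^sup>2 x - N\<^sup>2 x\<parallel>\<^sup>2 \<le> N\<^sup>2 (N\<^sup>2 \<parallel>x\<parallel>\<^sup>2 - \<parallel>y x\<parallel>\<^sup>2)\<close>. If \<open>y = Q(z)\<close> where \<open>Q\<close> vanishes on the spectrum
  and \<open>N \<noteq> 0\<close>, the roots of \<open>Q\<^sup>2 - N\<^sup>2\<close> avoid the spectrum, which contradicts lemma \<open>poly_op_bounded_below\<close>.
\<close>

lemma selfadjoint_poly_op_eq_0:
  fixes z :: "'a::complex_hilbert_space \<Rightarrow> 'a"
  assumes z: "bounded_clinear z" and ne: "spectrum z \<noteq> {}"
    and Q: "\<And>\<mu>. \<mu> \<in> spectrum z \<Longrightarrow> poly Q \<mu> = 0"
    and sa: "selfadjoint (poly_op Q z)"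
  shows "poly_op Q z x = 0"
proof -
  define y where "y = poly_op Q z"
  define N where "N = onorm y"
  have bl: "bounded_linear y"
    unfolding y_def using bounded_clinear_poly_op[OF z] by (rule bounded_clinearD)
  have yN: "norm (y x) \<le> N * norm x" for x
    unfolding N_def by (rule onorm[OF bl])
  have "N = 0"
  proof (rule ccontr)
    assume "N \<noteq> 0"
    then have "N > 0" using onorm_pos_le[OF bl] N_def by simp
    let ?P = "Q * Q - [:complex_of_real (N\<^sup>2):]"
    have P: "\<mu> \<notin> spectrum z" if "poly ?P \<mu> = 0" for \<mu>
      using that Q[of \<mu>] \<open>N > 0\<close> by auto
    then have "?P \<noteq> 0" using ne by (metis all_not_in_conv poly_0)
    then obtain C where C: "C > 0" "\<And>x. norm x \<le> C * norm (poly_op ?P z x)"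
      using poly_op_bounded_below[OF z, of ?P] P by blast
    define M where "M = sqrt (max 0 (N\<^sup>2 - 1 / (C\<^sup>2 * N\<^sup>2)))"
    have "norm (y x) \<le> M * norm x" for x
    proof -
      have Px: "poly_op ?P z x = y (y x) - N\<^sup>2 *\<^sub>R x"
        unfolding poly_op_diff poly_op_mult[OF z] poly_op_const[OF z] y_def scaleR_scaleC ..
      have norm_diff_sq: "(norm (v - c *\<^sub>R w))\<^sup>2 = (norm v)\<^sup>2 - 2 * c * inner v w + c\<^sup>2 * (norm w)\<^sup>2"
        for v w :: 'a and c
        unfolding power2_norm_eq_inner
        by (simp add: inner_diff_left inner_diff_right inner_commute power2_eq_square)
      have "(norm (y (y x)))\<^sup>2 \<le> (N * norm (y x))\<^sup>2"
        using yN[of "y x"] by (intro power_mono) auto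
      moreover have "inner (y (y x)) x = (norm (y x))\<^sup>2"
        using selfadjointD(3)[OF sa, of "y x" x] by (simp add: y_def power2_norm_eq_inner)
      ultimately have "(norm (y (y x) - N\<^sup>2 *\<^sub>R x))\<^sup>2 \<le> N\<^sup>2 * (N\<^sup>2 * (norm x)\<^sup>2 - (norm (y x))\<^sup>2)"
        unfolding norm_diff_sq
        by (simp add: power_mult_distrib algebra_simps power2_eq_square)
      then have "C\<^sup>2 * (norm (poly_op ?P z x))\<^sup>2 \<le> C\<^sup>2 * (N\<^sup>2 * (N\<^sup>2 * (norm x)\<^sup>2 - (norm (y x))\<^sup>2))"
        unfolding Px by (intro mult_left_mono) auto
      moreover have "(norm x)\<^sup>2 \<le> C\<^sup>2 * (norm (poly_op ?P z x))\<^sup>2"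
        using C(2)[of x] by (metis norm_ge_zero power_mono power_mult_distrib)
      ultimately have "(norm x)\<^sup>2 \<le> (C\<^sup>2 * N\<^sup>2) * (N\<^sup>2 * (norm x)\<^sup>2 - (norm (y x))\<^sup>2)"
        by (simp add: mult.assoc)
      moreover have "C\<^sup>2 * N\<^sup>2 > 0" using C(1) \<open>N > 0\<close> by simp
      ultimately have "(norm x)\<^sup>2 / (C\<^sup>2 * N\<^sup>2) \<le> N\<^sup>2 * (norm x)\<^sup>2 - (norm (y x))\<^sup>2"
        by (simp only: pos_divide_le_eq mult.commute)
      then have "(norm (y x))\<^sup>2 \<le> (N\<^sup>2 - 1 / (C\<^sup>2 * N\<^sup>2)) * (norm x)\<^sup>2"
        by (simp add: left_diff_distrib)
      also have "\<dots> \<le> M\<^sup>2 * (norm x)\<^sup>2"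
        unfolding M_def by (intro mult_right_mono) auto
      finally have "(norm (y x))\<^sup>2 \<le> (M * norm x)\<^sup>2"
        by (simp add: power_mult_distrib)
      then show ?thesis
        by (rule power2_le_imp_le) (simp add: M_def)
    qed
    then have "N \<le> M"
      unfolding N_def by (intro onorm_bound) (auto simp: M_def)
    moreover have "M < sqrt (N\<^sup>2)"
      unfolding M_def using \<open>N > 0\<close> C(1) by (intro real_sqrt_less_mono) auto
    ultimately show False using \<open>N > 0\<close> by simp
  qed
  then show ?thesis using yN[of x] by (simp add: y_def)
qed

lemma prod_linear_factors_dvd:
  fixes Q :: "'a::field poly"
  assumes "finite S" "\<And>s. s \<in> S \<Longrightarrow> poly Q s = 0"
  shows "(\<Prod>s\<in>S. [:- s, 1:]) dvd Q"
  using assms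
proof (induction S arbitrary: Q rule: finite_induct)
  case (insert s S)
  then obtain Q' where Q': "Q = [:- s, 1:] * Q'"
    by (metis dvdE insertI1 poly_eq_0_iff_dvd)
  have "poly Q' t = 0" if "t \<in> S" for t
    using insert.prems[of t] insert.hyps(2) that unfolding Q' by auto
  then show ?case
    using insert.IH[of Q'] insert.hyps by (simp add: Q' mult_dvd_mono del: mult_pCons_left)
qed simp

lemma selfadjoint_poly_op_prod:
  assumes z: "selfadjoint z" and "finite S"
  shows "selfadjoint (poly_op (\<Prod>s\<in>S. [:- complex_of_real s, 1:]) z)"
  using \<open>finite S\<close>
proof (induction S rule: finite_induct)
  case empty
  show ?case
    using bounded_clinear_poly_op[OF selfadjointD(1)[OF z]] selfadjointD(1)[OF z] bounded_clinear_ident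
    by (simp add: selfadjoint_def one_pCons poly_op_const scaleC_one)
next
  case (insert s S)
  let ?P = "\<Prod>s\<in>S. [:- complex_of_real s, 1:]" and ?l = "[:- complex_of_real s, 1:]"
  note bc = selfadjointD(1)[OF z]
  have l: "cinner (poly_op ?l z x) y = cinner x (poly_op ?l z y)" for x y
    by (simp add: poly_op_linear_poly[OF bc] cinner_add_left cinner_add_right cinner_scaleC_left
        cinner_diff_left cinner_diff_right
        cinner_scaleC_right selfadjointD(2)[OF z] scaleC_one cinner_minus_left cinner_minus_right)
  have "cinner (poly_op (?l * ?P) z x) y = cinner x (poly_op (?P * ?l) z y)" for x y
    by (simp only: poly_op_mult[OF bc] l selfadjointD(2)[OF insert.IH])
  then show ?case
    using bounded_clinear_poly_op[OF bc] insert.hyps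
    by (simp add: selfadjoint_def mult.commute del: mult_pCons_left mult_pCons_right)
qed

text \<open>
  Lemma \<open>selfadjoint_poly_op_eq_0\<close> applies to the product of the \<open>X - s\<close>, which has real coefficients and is
  therefore selfadjoint at \<open>z\<close>. It divides every polynomial, real or not, that vanishes on the spectrum.
\<close>

lemma poly_op_eq_0:
  assumes z: "selfadjoint z" and S: "finite S" "S \<noteq> {}" "spectrum z = complex_of_real ` S"
    and Q: "\<And>s. s \<in> S \<Longrightarrow> poly Q (complex_of_real s) = 0"
  shows "poly_op Q z x = 0"
proof -
  let ?P = "\<Prod>s\<in>S. [:- complex_of_real s, 1:]"
  note bc = selfadjointD(1)[OF z]
  have "?P = (\<Prod>s\<in>complex_of_real ` S. [:- s, 1:])"
    by (simp add: prod.reindex inj_on_def)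
  then have "?P dvd Q"
    using prod_linear_factors_dvd[of "complex_of_real ` S" Q] S(1) Q by auto
  then obtain R where "Q = ?P * R" by blast
  moreover have "poly_op ?P z y = 0" for y
    using S by (intro selfadjoint_poly_op_eq_0 bc selfadjoint_poly_op_prod z) (auto simp: poly_prod)
  ultimately show ?thesis
    by (simp add: poly_op_mult[OF bc])
qed

definition lagrange_poly :: "real set \<Rightarrow> real \<Rightarrow> complex poly" where
  "lagrange_poly S s = smult (complex_of_real (inverse (\<Prod>t\<in>S - {s}. s - t)))
     (\<Prod>t\<in>S - {s}. [:- complex_of_real t, 1:])"

lemma poly_lagrange_poly:
  assumes "finite S" "s \<in> S" "t \<in> S"
  shows "poly (lagrange_poly S s) (complex_of_real t) = (if t = s then 1 else 0)"
proof (cases "t = s")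
  case True
  have "(\<Prod>t\<in>S - {s}. s - t) \<noteq> 0" using assms by auto
  then show ?thesis using True
    by (simp add: lagrange_poly_def poly_prod flip: of_real_diff of_real_prod of_real_mult of_real_inverse)
next
  case False
  then have "(\<Prod>r\<in>S - {s}. poly [:- complex_of_real r, 1:] (complex_of_real t)) = 0"
    using assms by (intro prod_zero) auto
  then show ?thesis using False
    by (simp add: lagrange_poly_def poly_prod)
qed

lemma selfadjoint_scaleC_real:
  "selfadjoint T \<Longrightarrow> selfadjoint (\<lambda>x. complex_of_real c *\<^sub>C T x)"
  by (simp add: selfadjoint_def bounded_clinear_scaleC cinner_scaleC_left cinner_scaleC_right)

lemma selfadjoint_lagrange:
  assumes "selfadjoint z" "finite S"
  shows "selfadjoint (poly_op (lagrange_poly S s) z)"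
proof -
  have "poly_op (lagrange_poly S s) z = (\<lambda>x. complex_of_real (inverse (\<Prod>t\<in>S - {s}. s - t)) *\<^sub>C
      poly_op (\<Prod>t\<in>S - {s}. [:- complex_of_real t, 1:]) z x)"
    unfolding lagrange_poly_def poly_op_smult fun_eq_iff by blast
  then show ?thesis
    using selfadjoint_scaleC_real[OF selfadjoint_poly_op_prod[OF assms(1), of "S - {s}"]] assms(2)
    by (simp del: of_real_inverse of_real_prod)
qed

lemma poly_op_interpolation:
  assumes z: "selfadjoint z" and S: "finite S" "S \<noteq> {}" "spectrum z = complex_of_real ` S"
  shows "poly_op P z x = (\<Sum>s\<in>S. poly P (complex_of_real s) *\<^sub>C poly_op (lagrange_poly S s) z x)"
proof -
  let ?Q = "P - (\<Sum>s\<in>S. smult (poly P (complex_of_real s)) (lagrange_poly S s))"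
  have "poly_op ?Q z x = 0"
  proof (rule poly_op_eq_0[OF z S])
    fix t assume t: "t \<in> S"
    then have "(\<Sum>s\<in>S. poly P (complex_of_real s) * poly (lagrange_poly S s) (complex_of_real t))
        = (\<Sum>s\<in>S. if t = s then poly P (complex_of_real s) else 0)"
      by (intro sum.cong) (auto simp: poly_lagrange_poly[OF S(1)])
    then show "poly ?Q (complex_of_real t) = 0"
      using t S(1) by (simp add: poly_sum)
  qed
  then show ?thesis
    by (simp add: poly_op_diff poly_op_sum poly_op_smult)
qed

text \<open>
  On a finite spectrum, \<open>P\<^sub>n(z)\<close> depends only on the values of \<open>P\<^sub>n\<close> at the points of the spectrum.
  So its limit is determined by the limits of these values, and is reached by the constant
  sequence of the Lagrange interpolation polynomial.
\<close>

lemma func_calc_indicator: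
  assumes z: "selfadjoint z" and S: "finite S" "S \<noteq> {}" "spectrum z = complex_of_real ` S"
    and s: "s \<in> S"
  shows "func_calc z (indicator {complex_of_real s}) = poly_op (lagrange_poly S s) z"
  unfolding func_calc_def
proof (rule the_equality)
  let ?E = "\<lambda>s. poly_op (lagrange_poly S s) z" and ?f = "indicator {complex_of_real s} :: complex \<Rightarrow> complex"
  note bc = selfadjointD(1)[OF z]
  have f: "?f (complex_of_real t) = (if t = s then 1 else 0)" for t
    by (auto simp: indicator_def)
  have "uniform_limit (spectrum z) (\<lambda>n::nat. poly (lagrange_poly S s)) ?f sequentially"
    unfolding S(3) using s by (intro uniform_limitI) (auto simp: poly_lagrange_poly[OF S(1)] f)
  moreover have "(\<lambda>n::nat. onorm (\<lambda>x. ?E s x - ?E s x)) \<longlonglongrightarrow> 0"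
    by (simp add: onorm_zero)
  ultimately show "bounded_clinear (?E s) \<and> (\<exists>P. uniform_limit (spectrum z) (\<lambda>n. poly (P n)) ?f sequentially \<and>
      (\<lambda>n. onorm (\<lambda>x. poly_op (P n) z x - ?E s x)) \<longlonglongrightarrow> 0)"
    using bounded_clinear_poly_op[OF bc] by (intro conjI exI[of _ "\<lambda>n. lagrange_poly S s"]) auto
  fix T assume "bounded_clinear T \<and> (\<exists>P. uniform_limit (spectrum z) (\<lambda>n. poly (P n)) ?f sequentially \<and>
      (\<lambda>n. onorm (\<lambda>x. poly_op (P n) z x - T x)) \<longlonglongrightarrow> 0)"
  then obtain P where T: "bounded_clinear T"
    and P: "uniform_limit (spectrum z) (\<lambda>n. poly (P n)) ?f sequentially"
    and lim: "(\<lambda>n. onorm (\<lambda>x. poly_op (P n) z x - T x)) \<longlonglongrightarrow> 0" by blast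
  show "T = ?E s"
  proof
    fix x
    have "(\<lambda>n. poly_op (P n) z x - T x) \<longlonglongrightarrow> 0"
    proof (rule Lim_null_comparison)
      show "\<forall>\<^sub>F n in sequentially. norm (poly_op (P n) z x - T x) \<le> onorm (\<lambda>x. poly_op (P n) z x - T x) * norm x"
        using onorm[OF bounded_clinearD(1)[OF bounded_clinear_diff[OF bounded_clinear_poly_op[OF bc] T]]] by simp
      show "(\<lambda>n. onorm (\<lambda>x. poly_op (P n) z x - T x) * norm x) \<longlonglongrightarrow> 0"
        using tendsto_mult_right[OF lim, of "norm x"] by simp
    qed
    then have 1: "(\<lambda>n. poly_op (P n) z x) \<longlonglongrightarrow> T x"
      by (simp add: LIM_zero_iff)
    have "(\<lambda>n. poly (P n) (complex_of_real t)) \<longlonglongrightarrow> ?f (complex_of_real t)" if "t \<in> S" for t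
      using that S(3) by (intro tendsto_uniform_limitI[OF P]) auto
    then have "(\<lambda>n. \<Sum>t\<in>S. poly (P n) (complex_of_real t) *\<^sub>C ?E t x) \<longlonglongrightarrow> (\<Sum>t\<in>S. ?f (complex_of_real t) *\<^sub>C ?E t x)"
      by (intro tendsto_sum bounded_linear.tendsto[OF bounded_linear_scaleC_left]) auto
    also have "(\<lambda>n. \<Sum>t\<in>S. poly (P n) (complex_of_real t) *\<^sub>C ?E t x) = (\<lambda>n. poly_op (P n) z x)"
      by (simp add: poly_op_interpolation[OF z S, of "P _"])
    also have "(\<Sum>t\<in>S. ?f (complex_of_real t) *\<^sub>C ?E t x) = (\<Sum>t\<in>S. if t = s then ?E t x else 0)"
      by (intro sum.cong) (auto simp: f scaleC_one)
    also have "\<dots> = ?E s x"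
      using S(1) s by simp
    finally show "T x = ?E s x"
      using 1 LIMSEQ_unique by blast
  qed
qed

lemma spectral_decomposition:
  fixes z :: "'a::complex_hilbert_space \<Rightarrow> 'a"
  assumes z: "selfadjoint z" and S: "finite S" "S \<noteq> {}" "spectrum z = complex_of_real ` S"
  defines "E \<equiv> \<lambda>s. func_calc z (indicator {complex_of_real s})"
  shows "\<And>s. s \<in> S \<Longrightarrow> projection (E s)"
    and "\<And>s t x. s \<in> S \<Longrightarrow> t \<in> S \<Longrightarrow> s \<noteq> t \<Longrightarrow> E s (E t x) = 0"
    and "\<And>x. (\<Sum>s\<in>S. E s x) = x"
    and "\<And>x. z x = (\<Sum>s\<in>S. s *\<^sub>R E s x)"
proof -
  let ?L = "lagrange_poly S"
  note bc = selfadjointD(1)[OF z] and L = poly_lagrange_poly[OF S(1)]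
  have E: "E s = poly_op (?L s) z" if "s \<in> S" for s
    unfolding E_def by (rule func_calc_indicator[OF z S that])
  show "E s (E t x) = 0" if "s \<in> S" "t \<in> S" "s \<noteq> t" for s t x
    unfolding E[OF that(1)] E[OF that(2)] poly_op_mult[OF bc, symmetric]
    by (rule poly_op_eq_0[OF z S]) (use that in \<open>auto simp: L\<close>)
  show "projection (E s)" if s: "s \<in> S" for s
    unfolding projection_def
  proof (intro conjI allI)
    show "selfadjoint (E s)"
      unfolding E[OF s] by (rule selfadjoint_lagrange[OF z S(1)])
    fix x
    have "poly_op (?L s * ?L s - ?L s) z x = 0"
      by (rule poly_op_eq_0[OF z S]) (use s in \<open>auto simp: L\<close>)
    then show "E s (E s x) = E s x"
      by (simp add: E[OF s] poly_op_diff poly_op_mult[OF bc])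
  qed
  show "(\<Sum>s\<in>S. E s x) = x" for x
    using poly_op_interpolation[OF z S, of "[:1:]" x] by (simp add: E poly_op_const[OF bc] scaleC_one)
  show "z x = (\<Sum>s\<in>S. s *\<^sub>R E s x)" for x
    using poly_op_interpolation[OF z S, of "[:0, 1:]" x]
    by (simp add: E poly_op_linear_poly[OF bc] scaleC_one scaleR_scaleC)
qed

section \<open>Projections and their traces\<close>

lemma bounded_clinear_funpow: "bounded_clinear T \<Longrightarrow> bounded_clinear (T ^^ n)"
proof (induction n)
  case 0
  then show ?case using bounded_clinear_ident by (simp add: id_def)
next
  case (Suc n)
  then show ?case using bounded_clinear_compose[of T "T ^^ n"] by (simp add: comp_def)
qed

lemma cinner_funpow:
  assumes "selfadjoint T" shows "cinner ((T ^^ n) x) y = cinner x ((T ^^ n) y)"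
proof (induction n arbitrary: x y)
  case (Suc n)
  have "cinner ((T ^^ Suc n) x) y = cinner x ((T ^^ n) (T y))"
    by (simp add: selfadjointD(2)[OF assms] Suc)
  then show ?case by (simp add: funpow_swap1)
qed simp

lemma projectionD:
  assumes "projection p"
  shows "selfadjoint p" "bounded_clinear p" "p (p x) = p x" "p x \<in> range p"
    and "x \<in> range p \<longleftrightarrow> p x = x" "inner (p x) x = (norm (p x))\<^sup>2" "norm (p x) \<le> norm x"
    and "(norm x)\<^sup>2 = (norm (p x))\<^sup>2 + (norm (x - p x))\<^sup>2"
proof -
  show sa: "selfadjoint p" and idem: "p (p x) = p x" for x
    using assms by (auto simp: projection_def)
  show "bounded_clinear p" by (rule selfadjointD(1)[OF sa])
  show "p x \<in> range p" by blast
  show "x \<in> range p \<longleftrightarrow> p x = x" by (metis idem imageE rangeI)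
  show 1: "inner (p x) x = (norm (p x))\<^sup>2"
    using selfadjointD(3)[OF sa, of "p x" x] by (simp add: idem power2_norm_eq_inner)
  then show 2: "(norm x)\<^sup>2 = (norm (p x))\<^sup>2 + (norm (x - p x))\<^sup>2"
    by (simp add: power2_norm_eq_inner inner_diff_left inner_diff_right inner_commute)
  show "norm (p x) \<le> norm x"
    by (rule power2_le_imp_le) (simp_all add: 2)
qed

lemma projection_range_closed_subspace:
  assumes "projection p"
  shows "closed (range p)" "cvec.subspace (range p)"
proof -
  note bc = projectionD(2)[OF assms]
  have "range p = {x. p x = x}"
    using projectionD(5)[OF assms] by blast
  moreover have "closed {x. p x = x}"
    by (intro closed_Collect_eq bounded_linear.continuous_on[OF bounded_clinearD(1)[OF bc]] continuous_intros)
  moreover have "cvec.subspace {x. p x = x}"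
    by (rule cvec.subspaceI) (auto simp: bounded_clinearD[OF bc])
  ultimately show "closed (range p)" "cvec.subspace (range p)" by auto
qed

text \<open>
  Orthonormal subsets of a range have at most \<open>\<Sum>\<^sub>k \<parallel>P e\<^sub>k\<parallel>\<^sup>2\<close> elements, so there is a largest
  one. It spans the range, and then the double sum of the \<open>|\<langle>e\<^sub>k, f\<rangle>|\<^sup>2\<close> shows that its size is the trace.
\<close>

lemma projection_dim_eq_trace:
  fixes P :: "'a::complex_hilbert_space \<Rightarrow> 'a"
  assumes P: "projection P" and e: "orthonormal_basis e"
    and sm: "summable (\<lambda>k. (norm (P (e k)))\<^sup>2)"
  shows "finite_cdim (range P)" and "real (cvec.dim (range P)) = (\<Sum>k. (norm (P (e k)))\<^sup>2)"
proof -
  define ons where "ons F \<longleftrightarrow> finite F \<and> F \<subseteq> range P \<and>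
    (\<forall>x\<in>F. \<forall>y\<in>F. cinner x y = (if x = y then 1 else 0))" for F
  note sa = projectionD(1)[OF P] and bc = projectionD(2)[OF P] and fix_iff = projectionD(5)[OF P]
  note sub = projection_range_closed_subspace(2)[OF P]
  have card_eq: "(\<lambda>k. \<Sum>f\<in>F. (cmod (cinner (P (e k)) f))\<^sup>2) sums real (card F)" if F: "ons F" for F
  proof -
    have "(\<lambda>k. \<Sum>f\<in>F. (cmod (cinner (P (e k)) f))\<^sup>2) sums (\<Sum>f\<in>F. 1)"
    proof (rule sums_sum)
      fix f assume f: "f \<in> F"
      have "cmod (cinner (P (e k)) f) = cmod (cinner f (e k))" for k
      proof -
        have "cinner (P (e k)) f = cinner (e k) f"
          using f F selfadjointD(2)[OF sa] fix_iff by (metis ons_def subsetD)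
        then show ?thesis by (metis cinner_commute complex_mod_cnj)
      qed
      moreover have "norm f = 1"
        using f F cinner_self[of f] unfolding ons_def
        by (metis norm_ge_zero of_real_eq_1_iff power2_eq_1_iff abs_norm_cancel abs_1 power2_eq_iff
            one_neq_neg_one neg_0_le_iff_le not_one_le_zero order_trans)
      ultimately show "(\<lambda>k. (cmod (cinner (P (e k)) f))\<^sup>2) sums 1"
        using parseval[OF e, of f] by simp
    qed
    then show ?thesis by simp
  qed
  have fourier: "f \<in> F \<Longrightarrow> cinner (x - (\<Sum>f\<in>F. cinner x f *\<^sub>C f)) f = 0"
      "(\<Sum>f\<in>F. (cmod (cinner x f))\<^sup>2) = (norm x)\<^sup>2 - (norm (x - (\<Sum>f\<in>F. cinner x f *\<^sub>C f)))\<^sup>2"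
      if "ons F" for F f x
    using orthonormal_fourier_sum[where I = F and e = "\<lambda>x. x" and x = x] that
    by (auto simp: ons_def)
  have card_le: "real (card F) \<le> (\<Sum>k. (norm (P (e k)))\<^sup>2)" if F: "ons F" for F
    using card_eq[OF F] sm
    by (intro sums_le[OF _ card_eq[OF F] summable_sums[OF sm]]) (simp add: fourier(2)[OF F])
  define P' where "P' n \<longleftrightarrow> (\<exists>F. ons F \<and> card F = n)" for n
  have "P' 0"
    unfolding P'_def ons_def by (intro exI[of _ "{}"]) simp
  moreover have "\<forall>m. P' m \<longrightarrow> m \<le> nat \<lfloor>\<Sum>k. (norm (P (e k)))\<^sup>2\<rfloor>"
    unfolding P'_def using le_nat_floor[OF card_le] by blast
  ultimately have "\<exists>n. P' n \<and> (\<forall>m. P' m \<longrightarrow> m \<le> n)"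
    by (rule Nat.ex_has_greatest_nat)
  then obtain F where F: "ons F" and max: "\<And>G. ons G \<Longrightarrow> card G \<le> card F"
    unfolding P'_def by blast
  \<comment> \<open>Otherwise the normalized remainder \<open>u\<close> would enlarge \<open>F\<close>.\<close>
  have expand: "x = (\<Sum>f\<in>F. cinner x f *\<^sub>C f)" if x: "x \<in> range P" for x
  proof (rule ccontr)
    assume neq: "x \<noteq> (\<Sum>f\<in>F. cinner x f *\<^sub>C f)"
    define w where "w = x - (\<Sum>f\<in>F. cinner x f *\<^sub>C f)"
    define u where "u = complex_of_real (inverse (norm w)) *\<^sub>C w"
    have w: "w \<noteq> 0" using neq by (simp add: w_def)
    have "w \<in> range P"
      unfolding w_def using F x
      by (intro cvec.subspace_diff[OF sub] cvec.subspace_sum[OF sub] cvec.subspace_scale[OF sub])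
         (auto simp: ons_def)
    then have u: "u \<in> range P"
      unfolding u_def by (rule cvec.subspace_scale[OF sub])
    have uu: "cinner u u = 1"
      using w by (simp add: cinner_self u_def norm_scaleC del: of_real_inverse)
    have uf: "cinner u f = 0" "cinner f u = 0" if "f \<in> F" for f
    proof -
      show "cinner u f = 0"
        using fourier(1)[OF F that, of x] by (simp add: u_def cinner_scaleC_left w_def)
      then show "cinner f u = 0" by (metis cinner_commute complex_cnj_zero)
    qed
    have "u \<notin> F" using uu uf(1) by auto
    moreover have "ons (insert u F)"
      using F u uu uf unfolding ons_def by auto
    ultimately show False
      using max[of "insert u F"] F by (simp add: ons_def)
  qed
  have span: "range P = cvec.span F"
  proof
    show "cvec.span F \<subseteq> range P"
      using F by (intro cvec.span_minimal sub) (auto simp: ons_def)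
    show "range P \<subseteq> cvec.span F"
    proof
      fix x assume "x \<in> range P"
      then show "x \<in> cvec.span F"
        by (subst expand) (auto intro: cvec.span_sum cvec.span_scale cvec.span_base)
    qed
  qed
  have "cvec.independent F"
  proof (rule cvec.independent_if_scalars_zero)
    show "finite F" using F by (simp add: ons_def)
    fix c f assume 0: "(\<Sum>x\<in>F. c x *\<^sub>C x) = 0" and f: "f \<in> F"
    have "0 = cinner (\<Sum>x\<in>F. c x *\<^sub>C x) f" by (simp add: 0)
    also have "\<dots> = (\<Sum>x\<in>F. if f = x then c x else 0)"
      unfolding cinner_sum_left cinner_scaleC_left
      using F f by (intro sum.cong) (auto simp: ons_def)
    also have "\<dots> = c f" using F f by (simp add: ons_def)
    finally show "c f = 0" by simp
  qed
  then have "cvec.dim (range P) = card F"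
    unfolding span by (rule cvec.dim_span_eq_card_independent)
  moreover have "(\<Sum>f\<in>F. (cmod (cinner (P x) f))\<^sup>2) = (norm (P x))\<^sup>2" for x
    using fourier(2)[OF F, of "P x"] expand[OF projectionD(4)[OF P], of x] by simp
  then have "(\<lambda>k. (norm (P (e k)))\<^sup>2) sums real (card F)"
    using card_eq[OF F] by simp
  ultimately show "real (cvec.dim (range P)) = (\<Sum>k. (norm (P (e k)))\<^sup>2)"
    by (simp add: sums_iff)
  show "finite_cdim (range P)"
    unfolding finite_cdim_def using F span by (auto simp: ons_def)
qed

lemma norm_Pythagorean_diff:
  fixes u v :: "'a::real_inner"
  assumes "inner (u - v) v = 0"
  shows "(norm u)\<^sup>2 = (norm v)\<^sup>2 + (norm (u - v))\<^sup>2" and "norm v \<le> norm u"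
proof -
  show "(norm u)\<^sup>2 = (norm v)\<^sup>2 + (norm (u - v))\<^sup>2"
    using assms by (simp add: power2_norm_eq_inner inner_diff_left inner_diff_right inner_commute)
  then show "norm v \<le> norm u"
    by (auto intro: power2_le_imp_le[OF _ norm_ge_zero])
qed

lemma proj_onto_unique:
  assumes "cvec.subspace S" "y \<in> S" "\<And>s. s \<in> S \<Longrightarrow> cinner (x - y) s = 0"
  shows "proj_onto S x = y"
  unfolding proj_onto_def
proof (rule the_equality)
  show "y \<in> S \<and> (\<forall>s\<in>S. cinner (x - y) s = 0)" using assms by blast
  fix w assume w: "w \<in> S \<and> (\<forall>s\<in>S. cinner (x - w) s = 0)"
  then have "w - y \<in> S" using assms by (intro cvec.subspace_diff) auto
  then have "cinner (x - y) (w - y) - cinner (x - w) (w - y) = 0"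
    using w assms(3) by simp
  then have "cinner (w - y) (w - y) = 0"
    by (simp add: cinner_diff_left)
  then show "w = y" by (simp add: cinner_self)
qed

lemma projection_proj_onto:
  assumes S: "cvec.subspace S" and ex: "\<And>x. \<exists>y\<in>S. \<forall>s\<in>S. cinner (x - y) s = 0"
  shows "projection (proj_onto S)"
proof -
  let ?P = "proj_onto S"
  have P: "?P x \<in> S" and orth: "\<And>s. s \<in> S \<Longrightarrow> cinner (x - ?P x) s = 0" for x
    using ex[of x] proj_onto_unique[OF S, of _ x] by auto
  have sa: "cinner (?P x) y = cinner x (?P y)" for x y
  proof -
    have "cinner (x - ?P x) (?P y) = 0" "cinner (y - ?P y) (?P x) = 0"
      using P orth by auto
    then have "cinner x (?P y) = cinner (?P x) (?P y)" "cinner y (?P x) = cinner (?P y) (?P x)"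
      by (auto simp: cinner_diff_left)
    then show ?thesis by (metis cinner_commute)
  qed
  have add: "?P (x + y) = ?P x + ?P y" for x y
  proof (rule proj_onto_unique[OF S])
    show "?P x + ?P y \<in> S" by (intro cvec.subspace_add S P)
    fix s assume "s \<in> S"
    then show "cinner (x + y - (?P x + ?P y)) s = 0"
      using orth[of s x] orth[of s y] by (simp add: cinner_diff_left cinner_add_left)
  qed
  have scale: "?P (c *\<^sub>C x) = c *\<^sub>C ?P x" for c x
  proof (rule proj_onto_unique[OF S])
    show "c *\<^sub>C ?P x \<in> S" by (intro cvec.subspace_scale S P)
    fix s assume "s \<in> S"
    then show "cinner (c *\<^sub>C x - c *\<^sub>C ?P x) s = 0"
      using orth[of s x] by (simp add: cinner_diff_left cinner_scaleC_left)
  qed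
  have norm: "norm (?P x) \<le> norm x * 1" for x
  proof -
    have "inner (x - ?P x) (?P x) = 0"
      using orth[OF P, of x x] by (simp flip: Re_cinner)
    then show ?thesis
      using norm_Pythagorean_diff(2) by auto
  qed
  have "bounded_linear ?P"
    by (rule bounded_linear_intro[OF add _ norm]) (simp add: scaleR_scaleC scale)
  moreover have "?P (?P x) = ?P x" for x
    using P[of x] by (intro proj_onto_unique[OF S]) auto
  ultimately show ?thesis
    using sa scale by (simp add: projection_def selfadjoint_def bounded_clinear_def)
qed

text \<open>
  The vectors that have an orthogonal projection onto the closed subspace \<open>S\<close> form a closed
  subspace, because taking the projection is a contraction and \<open>S\<close> is complete. As it contains every basis vector, it is everything.
\<close>

lemma proj_onto_basis_span:
  fixes e :: "nat \<Rightarrow> 'a::complex_hilbert_space" and I :: "nat set"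
  assumes e: "orthonormal_basis e"
  defines "Q \<equiv> proj_onto (closure (cvec.span {e k | k. k \<in> I}))"
  shows "projection Q" and "Q (e k) = (if k \<in> I then e k else 0)"
proof -
  define S where "S = closure (cvec.span {e k | k. k \<in> I})"
  have sub: "cvec.subspace S" unfolding S_def by (intro closure_subspace cvec.subspace_span)
  have clS: "closed S" by (simp add: S_def)
  define G where "G = {x. \<exists>y\<in>S. \<forall>s\<in>S. cinner (x - y) s = 0}"
  have in_S: "e k \<in> S" if "k \<in> I" for k
    unfolding S_def using that by (intro closure_subset[THEN subsetD] cvec.span_base) auto
  have orth: "cinner (e k) s = 0" if "k \<notin> I" "s \<in> S" for k s
  proof -
    have "cinner s (e k) = 0"
      using that(2) unfolding S_def
      by (rule cinner_closure_span_eq_0) (use that(1) orthonormal_basisD(1)[OF e] in auto)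
    then show ?thesis by (metis cinner_commute complex_cnj_zero)
  qed
  have basis_G: "e k \<in> G" for k
    using in_S[of k] orth[of k] cvec.subspace_0[OF sub] unfolding G_def
    by (cases "k \<in> I") (auto intro: bexI[of _ "e k"] bexI[of _ 0])
  have "cvec.subspace G"
  proof (rule cvec.subspaceI)
    show "0 \<in> G" unfolding G_def using cvec.subspace_0[OF sub] by (auto intro: bexI[of _ 0])
  next
    fix x y assume "x \<in> G" "y \<in> G"
    then obtain u v where "u \<in> S" "\<forall>s\<in>S. cinner (x - u) s = 0" "v \<in> S" "\<forall>s\<in>S. cinner (y - v) s = 0"
      unfolding G_def by blast
    then show "x + y \<in> G"
      unfolding G_def
      by (auto simp: cinner_diff_left cinner_add_left intro!: bexI[of _ "u + v"] cvec.subspace_add[OF sub])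
  next
    fix c x assume "x \<in> G"
    then obtain u where "u \<in> S" "\<forall>s\<in>S. cinner (x - u) s = 0"
      unfolding G_def by blast
    then show "c *\<^sub>C x \<in> G"
      unfolding G_def
      by (auto simp: cinner_diff_left cinner_scaleC_left intro!: bexI[of _ "c *\<^sub>C u"] cvec.subspace_scale[OF sub])
  qed
  moreover have "closed G"
    unfolding closed_sequential_limits
  proof (intro allI impI)
    fix x l assume "(\<forall>n. x n \<in> G) \<and> x \<longlonglongrightarrow> l"
    then have x: "\<And>n. x n \<in> G" "x \<longlonglongrightarrow> l" by auto
    then have "\<forall>n. \<exists>u. u \<in> S \<and> (\<forall>s\<in>S. cinner (x n - u) s = 0)"
      unfolding G_def by blast
    then obtain y where y: "\<And>n. y n \<in> S" "\<And>n s. s \<in> S \<Longrightarrow> cinner (x n - y n) s = 0"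
      by metis
    have contr: "dist (y m) (y n) \<le> dist (x m) (x n)" for m n
    proof -
      let ?u = "x m - x n" and ?v = "y m - y n"
      have "?v \<in> S" by (intro cvec.subspace_diff sub y)
      then have "cinner (x m - y m) ?v - cinner (x n - y n) ?v = 0"
        using y(2) by simp
      then have "inner (?u - ?v) ?v = 0"
        unfolding Re_cinner[symmetric] cinner_diff_left by (simp add: algebra_simps)
      then show ?thesis
        unfolding dist_norm by (rule norm_Pythagorean_diff(2))
    qed
    have "Cauchy y"
    proof (rule metric_CauchyI)
      fix r :: real assume "r > 0"
      then obtain N where "\<forall>m\<ge>N. \<forall>n\<ge>N. dist (x m) (x n) < r"
        using metric_CauchyD[OF LIMSEQ_imp_Cauchy[OF x(2)]] by blast
      then show "\<exists>N. \<forall>m\<ge>N. \<forall>n\<ge>N. dist (y m) (y n) < r"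
        using contr le_less_trans by blast
    qed
    then obtain w where w: "y \<longlonglongrightarrow> w"
      using Cauchy_convergent convergent_def by blast
    have "w \<in> S"
      using clS y(1) w closed_sequentially by blast
    moreover have "cinner (l - w) s = 0" if "s \<in> S" for s
    proof -
      have "(\<lambda>n. cinner (x n - y n) s) \<longlonglongrightarrow> cinner (l - w) s"
        by (intro bounded_linear.tendsto[OF bounded_linear_cinner_left] tendsto_diff x w)
      then show ?thesis using y(2)[OF that] by (simp add: LIMSEQ_const_iff)
    qed
    ultimately show "l \<in> G" unfolding G_def by blast
  qed
  ultimately have "closure (cvec.span (range e)) \<subseteq> G"
    using basis_G by (intro closure_minimal cvec.span_minimal) auto
  then have "\<exists>y\<in>S. \<forall>s\<in>S. cinner (x - y) s = 0" for x
    using orthonormal_basisD(2)[OF e, of x] unfolding G_def by blast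
  then show "projection Q"
    unfolding Q_def S_def[symmetric] by (intro projection_proj_onto sub)
  show "Q (e k) = (if k \<in> I then e k else 0)"
    unfolding Q_def S_def[symmetric] using in_S[of k] orth[of k] cvec.subspace_0[OF sub]
    by (intro proj_onto_unique[OF sub]) auto
qed

lemma Tr_projection:
  fixes P :: "'a::complex_hilbert_space \<Rightarrow> 'a"
  assumes P: "projection P" and e: "orthonormal_basis e"
  shows "Tr P = (\<Sum>k. ennreal ((norm (P (e k)))\<^sup>2))"
proof -
  define f where "f = (SOME f :: nat \<Rightarrow> 'a. orthonormal_basis f)"
  have f: "orthonormal_basis f" unfolding f_def by (rule someI[of orthonormal_basis, OF e])
  have "Tr P = (\<Sum>k. ennreal ((norm (P (f k)))\<^sup>2))"
    unfolding Tr_def Let_def f_def[symmetric] by (simp add: Re_cinner projectionD(6)[OF P])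
  also have "\<dots> = (\<Sum>k. ennreal ((norm (P (e k)))\<^sup>2))"
    by (rule hilbert_schmidt_adjoint_ennreal[OF f e selfadjointD(2)[OF projectionD(1)[OF P]]])
  finally show ?thesis .
qed

section \<open>Pairs of projections with Hilbert-Schmidt difference\<close>

lemma hilbert_schmidt_add:
  fixes A B :: "'a::real_inner \<Rightarrow> 'b::real_inner"
  assumes "summable (\<lambda>k. (norm (A (e k)))\<^sup>2)" "summable (\<lambda>k. (norm (B (e k)))\<^sup>2)"
  shows "summable (\<lambda>k. (norm (A (e k) + B (e k)))\<^sup>2)"
    and "summable (\<lambda>k. (norm (A (e k) - B (e k)))\<^sup>2)"
proof -
  have sm: "summable (\<lambda>k. 2 * ((norm (A (e k)))\<^sup>2 + (norm (B (e k)))\<^sup>2))"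
    using assms by (intro summable_mult summable_add)
  have eq: "(norm (x + y))\<^sup>2 + (norm (x - y))\<^sup>2 = 2 * ((norm x)\<^sup>2 + (norm y)\<^sup>2)" for x y :: 'b
    by (simp add: power2_norm_eq_inner inner_diff_left inner_diff_right inner_add_left inner_add_right)
  have "(norm (x + y))\<^sup>2 \<le> 2 * ((norm x)\<^sup>2 + (norm y)\<^sup>2)" "(norm (x - y))\<^sup>2 \<le> 2 * ((norm x)\<^sup>2 + (norm y)\<^sup>2)" for x y :: 'b
    unfolding eq[symmetric] by simp_all
  then show "summable (\<lambda>k. (norm (A (e k) + B (e k)))\<^sup>2)" "summable (\<lambda>k. (norm (A (e k) - B (e k)))\<^sup>2)"
    by (auto intro!: summable_comparison_test'[OF sm, of 0])
qed

text \<open>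
  Polarization of the equality of Hilbert-Schmidt norms. This is the cyclicity of the trace,
  \<open>Re tr(B\<^sup>* A) = Re tr(A B\<^sup>*)\<close>, with both traces written as real inner products.
\<close>

lemma hilbert_schmidt_adjoint_inner:
  fixes A B A' B' :: "'a::complex_hilbert_space \<Rightarrow> 'a"
  assumes e: "orthonormal_basis e"
    and A: "\<And>x y. cinner (A x) y = cinner x (A' y)" "summable (\<lambda>k. (norm (A (e k)))\<^sup>2)"
    and B: "\<And>x y. cinner (B x) y = cinner x (B' y)" "summable (\<lambda>k. (norm (B (e k)))\<^sup>2)"
  shows "(\<Sum>k. inner (A (e k)) (B (e k))) = (\<Sum>k. inner (A' (e k)) (B' (e k)))"
proof -
  have pol: "inner x y = ((norm (x + y))\<^sup>2 - (norm (x - y))\<^sup>2) / 4" for x y :: 'a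
    by (simp add: power2_norm_eq_inner inner_diff_left inner_diff_right inner_add_left
        inner_add_right inner_commute)
  note hs = hilbert_schmidt_add[of A e B, OF A(2) B(2)]
  have plus: "cinner (A x + B x) y = cinner x (A' y + B' y)" and minus: "cinner (A x - B x) y = cinner x (A' y - B' y)" for x y
    by (simp_all add: cinner_add_left cinner_add_right cinner_diff_left cinner_diff_right A B)
  note p = hilbert_schmidt_adjoint[where A = "\<lambda>x. A x + B x" and B = "\<lambda>x. A' x + B' x", OF e plus hs(1)]
  note m = hilbert_schmidt_adjoint[where A = "\<lambda>x. A x - B x" and B = "\<lambda>x. A' x - B' x", OF e minus hs(2)]
  show ?thesis
    unfolding pol
    using p m hs by (simp add: suminf_divide summable_diff flip: suminf_diff)
qed

text \<open>
  The operator norm is at most the Hilbert-Schmidt norm, by Parseval for \<open>A x\<close> and Cauchy-Schwarz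
  for each \<open>\<langle>A x, e\<^sub>k\<rangle> = \<langle>x, A e\<^sub>k\<rangle>\<close>.
\<close>

lemma hilbert_schmidt_norm_bound:
  fixes A :: "'a::complex_hilbert_space \<Rightarrow> 'a"
  assumes e: "orthonormal_basis e" and A: "\<And>x y. cinner (A x) y = cinner x (A y)"
    and sm: "summable (\<lambda>k. (norm (A (e k)))\<^sup>2)"
  shows "(norm (A x))\<^sup>2 \<le> (\<Sum>k. (norm (A (e k)))\<^sup>2) * (norm x)\<^sup>2"
proof (rule sums_le)
  show "(\<lambda>k. (cmod (cinner (A x) (e k)))\<^sup>2) sums (norm (A x))\<^sup>2"
    by (rule parseval[OF e])
  show "(\<lambda>k. (norm (A (e k)))\<^sup>2 * (norm x)\<^sup>2) sums ((\<Sum>k. (norm (A (e k)))\<^sup>2) * (norm x)\<^sup>2)"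
    by (intro sums_mult2 summable_sums sm)
  fix k
  have "cmod (cinner (A x) (e k)) \<le> norm (A (e k)) * norm x"
    using cmod_cinner_le[of x "A (e k)"] by (simp add: A mult.commute)
  then show "(cmod (cinner (A x) (e k)))\<^sup>2 \<le> (norm (A (e k)))\<^sup>2 * (norm x)\<^sup>2"
    by (metis norm_ge_zero power_mono power_mult_distrib)
qed

lemma dominated_suminf_tendsto:
  fixes a :: "nat \<Rightarrow> nat \<Rightarrow> real"
  assumes "\<And>k. (\<lambda>n. a k n) \<longlonglongrightarrow> b k" "\<And>k n. \<bar>a k n\<bar> \<le> M k" "summable M"
  shows "(\<lambda>n. \<Sum>k. a k n) \<longlonglongrightarrow> (\<Sum>k. b k)" and "summable b"
proof -
  have ev: "\<forall>\<^sub>F (k, n) in at_top \<times>\<^sub>F sequentially. norm (a k n) \<le> M k"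
    using assms(2) by (auto intro: always_eventually)
  have "summable (\<lambda>n. norm (b n))"
    using tannerys_theorem[of a b sequentially M, OF assms(1) ev assms(3)] by simp
  then show "summable b" by (rule summable_norm_cancel)
  show "(\<lambda>n. \<Sum>k. a k n) \<longlonglongrightarrow> (\<Sum>k. b k)"
    using tannerys_theorem[of a b sequentially M, OF assms(1) ev assms(3)] by simp
qed

locale hs_projection_pair =
  fixes p q :: "'a::complex_hilbert_space \<Rightarrow> 'a" and e :: "nat \<Rightarrow> 'a"
  assumes p: "projection p" and q: "projection q" and e: "orthonormal_basis e"
    and hs: "summable (\<lambda>k. (norm (p (e k) - q (e k)))\<^sup>2)"
begin

lemma swap: "hs_projection_pair q p e"
  using p q e hs by unfold_locales (auto simp: norm_minus_commute)

definition D :: "'a \<Rightarrow> 'a" where "D x = p x - q x"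
definition K :: "'a \<Rightarrow> 'a" where "K x = D (D x)"

lemmas p_simps = bounded_clinearD[OF projectionD(2)[OF p]] projectionD(3)[OF p]
lemmas q_simps = bounded_clinearD[OF projectionD(2)[OF q]] projectionD(3)[OF q]
lemmas p_inner = selfadjointD(3)[OF projectionD(1)[OF p]]
lemmas q_inner = selfadjointD(3)[OF projectionD(1)[OF q]]

lemma selfadjoint_D: "selfadjoint D"
proof -
  have "D = (\<lambda>x. p x - q x)" by (simp add: D_def fun_eq_iff)
  then show ?thesis
    using bounded_clinear_diff[OF projectionD(2)[OF p] projectionD(2)[OF q]]
    by (simp add: selfadjoint_def cinner_diff_left cinner_diff_right
        selfadjointD(2)[OF projectionD(1)[OF p]] selfadjointD(2)[OF projectionD(1)[OF q]])
qed

lemma K_eq: "K = D ^^ 2"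
  by (simp add: fun_eq_iff K_def numeral_2_eq_2)

lemma K_funpow: "K ^^ n = D ^^ (2 * n)"
  by (simp add: K_eq funpow_mult)

lemma bounded_clinear_D: "bounded_clinear D"
  by (rule selfadjointD(1)[OF selfadjoint_D])

lemma bounded_clinear_Kn: "bounded_clinear (K ^^ n)"
  unfolding K_funpow by (intro bounded_clinear_funpow bounded_clinear_D)

lemmas Kn_simps = bounded_clinearD[OF bounded_clinear_Kn]

lemma Dn_cinner: "cinner ((D ^^ n) x) y = cinner x ((D ^^ n) y)"
  by (rule cinner_funpow[OF selfadjoint_D])

lemma Kn_cinner: "cinner ((K ^^ n) x) y = cinner x ((K ^^ n) y)"
  unfolding K_funpow by (rule Dn_cinner)

lemma Dn_inner: "inner ((D ^^ n) x) y = inner x ((D ^^ n) y)"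
  using Dn_cinner[of n x y] by (simp flip: Re_cinner)

lemma Dn_Dn: "(D ^^ n) ((D ^^ n) x) = (K ^^ n) x"
proof -
  have "D ^^ n \<circ> D ^^ n = K ^^ n"
    unfolding K_funpow mult_2 funpow_add ..
  then show ?thesis by (simp add: fun_eq_iff)
qed

lemma K_expand: "K x = p x - p (q x) - q (p x) + q x"
  by (simp add: K_def D_def p_simps q_simps)

lemma K_p: "K (p x) = p (K x)" "K (p x) = p x - p (q (p x))"
  and K_q: "K (q x) = q (K x)" "K (q x) = q x - q (p (q x))"
  by (simp_all add: K_expand p_simps q_simps)

lemma Kn_p: "(K ^^ n) (p x) = p ((K ^^ n) x)" and Kn_q: "(K ^^ n) (q x) = q ((K ^^ n) x)"
  by (induction n) (simp_all add: K_p K_q)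

text \<open>\<open>D = (1 - q) p - q (1 - p)\<close>, where both the ranges and the initial spaces are orthogonal.\<close>

lemma norm_D_le: "norm (D x) \<le> norm x"
proof (rule power2_le_imp_le)
  let ?u = "p x" and ?v = "x - p x"
  have "D x = (?u - q ?u) - q ?v"
    by (simp add: D_def q_simps)
  moreover have "inner (?u - q ?u) (q ?v) = 0"
    using q_inner[of ?u "q ?v"] by (simp add: inner_diff_left q_simps)
  ultimately have "(norm (D x))\<^sup>2 = (norm (?u - q ?u))\<^sup>2 + (norm (q ?v))\<^sup>2"
    by (simp add: power2_norm_eq_inner inner_diff_left[of "?u - q ?u"] inner_diff_right[of _ "?u - q ?u"] inner_commute)
  also have "\<dots> \<le> (norm ?u)\<^sup>2 + (norm ?v)\<^sup>2"
    using projectionD(8)[OF q, of ?u] projectionD(7)[OF q, of ?v]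
    by (intro add_mono) (auto intro: power_mono)
  finally show "(norm (D x))\<^sup>2 \<le> (norm x)\<^sup>2"
    by (simp flip: projectionD(8)[OF p])
qed simp

lemma norm_Dn_antimono: "m \<le> n \<Longrightarrow> norm ((D ^^ n) x) \<le> norm ((D ^^ m) x)"
  by (rule lift_Suc_antimono_le[of "\<lambda>n. norm ((D ^^ n) x)"]) (simp_all add: norm_D_le)

lemma norm_Kn_le_D: "norm ((K ^^ Suc n) x) \<le> norm (D x)"
  using norm_Dn_antimono[of 1 "2 * Suc n" x] unfolding K_funpow by simp

lemma Kn_le: "norm ((K ^^ n) x) \<le> norm x"
  using norm_Dn_antimono[of 0 "2 * n" x] unfolding K_funpow by simp

text \<open>
  \<open>\<langle>K\<^sup>n x, x\<rangle> = \<parallel>D\<^sup>n x\<parallel>\<^sup>2\<close> decreases to a limit, and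
  \<open>\<parallel>K\<^sup>m x - K\<^sup>n x\<parallel>\<^sup>2\<close> is a combination of its values at \<open>2m\<close>, \<open>m + n\<close> and \<open>2n\<close>. So the powers
  of the positive contraction \<open>K\<close> converge strongly.
\<close>

lemma Kn_Cauchy: "Cauchy (\<lambda>n. (K ^^ n) x)"
proof (rule metric_CauchyI)
  define s where "s n = (norm ((D ^^ n) x))\<^sup>2" for n
  have inner_K: "inner ((K ^^ m) x) ((K ^^ n) x) = s (m + n)" for m n
  proof -
    have "inner ((K ^^ m) x) ((K ^^ n) x) = inner x ((K ^^ (m + n)) x)"
      using Kn_cinner[of m x "(K ^^ n) x"] by (simp add: funpow_add flip: Re_cinner)
    also have "\<dots> = inner ((D ^^ (m + n)) x) ((D ^^ (m + n)) x)"
      by (simp add: Dn_inner Dn_Dn)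
    finally show ?thesis by (simp add: s_def power2_norm_eq_inner)
  qed
  have "decseq s"
    unfolding s_def by (intro decseq_SucI power_mono norm_Dn_antimono) auto
  moreover have "Bseq s"
    using norm_Dn_antimono[of 0 _ x] by (intro BseqI'[of _ "s 0"]) (simp add: s_def power_mono)
  ultimately have "convergent s"
    by (intro Bseq_monoseq_convergent decseq_imp_monoseq)
  then have Cs: "Cauchy s" by (rule convergent_Cauchy)
  fix r :: real assume "r > 0"
  then obtain N where N: "\<And>m n. m \<ge> N \<Longrightarrow> n \<ge> N \<Longrightarrow> \<bar>s m - s n\<bar> < r\<^sup>2 / 2"
    using metric_CauchyD[OF Cs, of "r\<^sup>2 / 2"] by (auto simp: dist_real_def)
  have "dist ((K ^^ m) x) ((K ^^ n) x) < r" if "m \<ge> N" "n \<ge> N" for m n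
  proof -
    have "(norm ((K ^^ m) x - (K ^^ n) x))\<^sup>2 = (s (m + m) - s (m + n)) + (s (n + n) - s (m + n))"
      by (simp add: power2_norm_eq_inner inner_diff_left inner_diff_right inner_K add.commute)
    moreover have "\<bar>s (m + m) - s (m + n)\<bar> < r\<^sup>2 / 2" "\<bar>s (n + n) - s (m + n)\<bar> < r\<^sup>2 / 2"
      using N[of "m + m" "m + n"] N[of "n + n" "m + n"] that by simp_all
    then have "(s (m + m) - s (m + n)) + (s (n + n) - s (m + n)) < r\<^sup>2"
      by linarith
    ultimately have "(norm ((K ^^ m) x - (K ^^ n) x))\<^sup>2 < r\<^sup>2"
      by simp
    then show ?thesis
      using \<open>r > 0\<close> by (simp add: dist_norm power2_less_imp_less)
  qed
  then show "\<exists>N. \<forall>m\<ge>N. \<forall>n\<ge>N. dist ((K ^^ m) x) ((K ^^ n) x) < r" by blast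
qed

definition L :: "'a \<Rightarrow> 'a" where "L x = lim (\<lambda>n. (K ^^ n) x)"

lemma Kn_tendsto: "(\<lambda>n. (K ^^ n) x) \<longlonglongrightarrow> L x"
  using Kn_Cauchy Cauchy_convergent convergent_LIMSEQ_iff unfolding L_def by blast

lemma L_unique: "(\<lambda>n. (K ^^ n) x) \<longlonglongrightarrow> y \<Longrightarrow> L x = y"
  using Kn_tendsto LIMSEQ_unique by blast

lemma K_L: "K (L x) = L x"
proof -
  have "(\<lambda>n. K ((K ^^ n) x)) \<longlonglongrightarrow> K (L x)"
    using bounded_linear.tendsto[OF bounded_clinearD(1)[OF bounded_clinear_Kn[of 1]] Kn_tendsto] by simp
  moreover have "(\<lambda>n. K ((K ^^ n) x)) \<longlonglongrightarrow> L x"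
    using LIMSEQ_Suc[OF Kn_tendsto[of x]] by simp
  ultimately show ?thesis using LIMSEQ_unique by blast
qed

lemma L_fixed: "K x = x \<Longrightarrow> L x = x"
proof (rule L_unique)
  assume "K x = x"
  then have "(K ^^ n) x = x" for n by (induction n) auto
  then show "(\<lambda>n. (K ^^ n) x) \<longlonglongrightarrow> x" by simp
qed

lemma L_p: "L (p x) = p (L x)" and L_q: "L (q x) = q (L x)"
  using bounded_linear.tendsto[OF p_simps(1) Kn_tendsto[of x]]
    bounded_linear.tendsto[OF q_simps(1) Kn_tendsto[of x]]
  by (auto intro!: L_unique simp: Kn_p Kn_q)

lemma norm_L_le_D: "norm (L x) \<le> norm (D x)"
  by (rule LIMSEQ_le_const2[OF tendsto_norm[OF LIMSEQ_Suc[OF Kn_tendsto]]])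
     (use norm_Kn_le_D in auto)

lemma projection_L: "projection L"
  unfolding projection_def selfadjoint_def bounded_clinear_def
proof (intro conjI allI)
  show "bounded_linear L"
  proof (rule bounded_linear_intro[where K = 1])
    show "L (x + y) = L x + L y" for x y
      using tendsto_add[OF Kn_tendsto[of x] Kn_tendsto[of y]] by (intro L_unique) (simp add: Kn_simps)
    show "L (r *\<^sub>R x) = r *\<^sub>R L x" for r x
      using tendsto_scaleR[OF tendsto_const Kn_tendsto[of x], of r] by (intro L_unique) (simp add: Kn_simps)
    show "norm (L x) \<le> norm x * 1" for x
      using order_trans[OF norm_L_le_D norm_D_le] by simp
  qed
  show "L (c *\<^sub>C x) = c *\<^sub>C L x" for c x
    using bounded_linear.tendsto[OF bounded_linear_scaleC Kn_tendsto[of x], of c]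
    by (intro L_unique) (simp add: Kn_simps)
  show "L (L x) = L x" for x
    by (rule L_fixed[OF K_L])
  show "cinner (L x) y = cinner x (L y)" for x y
  proof -
    have "(\<lambda>n. cinner ((K ^^ n) x) y) \<longlonglongrightarrow> cinner (L x) y"
      by (rule bounded_linear.tendsto[OF bounded_linear_cinner_left Kn_tendsto])
    moreover have "(\<lambda>n. cnj (cinner ((K ^^ n) y) x)) \<longlonglongrightarrow> cnj (cinner (L y) x)"
      by (intro tendsto_cnj bounded_linear.tendsto[OF bounded_linear_cinner_left Kn_tendsto])
    moreover have "cnj (cinner ((K ^^ n) y) x) = cinner ((K ^^ n) x) y" for n
      by (simp add: Kn_cinner flip: cinner_commute)
    moreover have "cnj (cinner (L y) x) = cinner x (L y)"
      by (simp flip: cinner_commute)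
    ultimately show ?thesis using LIMSEQ_unique by auto
  qed
qed

lemma projection_Lp: "projection (\<lambda>x. L (p x))"
  unfolding projection_def selfadjoint_def
  using bounded_clinear_compose[OF projectionD(2)[OF projection_L] projectionD(2)[OF p]]
    selfadjointD(2)[OF projectionD(1)[OF projection_L]] selfadjointD(2)[OF projectionD(1)[OF p]]
  by (simp add: L_p p_simps projectionD(3)[OF projection_L])

lemma fixed_K_kernel:
  assumes "p x = x" shows "K x = x \<longleftrightarrow> q x = 0"
proof
  assume "K x = x"
  then have "p (q x) = 0" using K_p(2)[of x] assms by simp
  moreover have "inner (q x) x = inner (p (q x)) x"
    using p_inner[of "q x" x] assms by simp
  ultimately show "q x = 0"
    using projectionD(6)[OF q, of x] by simp
next
  assume "q x = 0"
  then show "K x = x" using K_p(2)[of x] assms by (simp add: p_simps)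
qed

text \<open>
  For \<open>x\<close> in the range of \<open>p\<close>, \<open>(1 - K) x = p q x\<close> and \<open>\<langle>p q x, x\<rangle> = \<parallel>q x\<parallel>\<^sup>2\<close>. So the fixed vectors of \<open>K\<close>
  there are the kernel of \<open>q\<close>, and \<open>L p\<close> is the projection onto the kernel of \<open>q\<close> restricted to \<open>ran p\<close>.
\<close>

lemma range_Lp: "range (\<lambda>x. L (p x)) = {x \<in> range p. q x = 0}"
proof (intro equalityI subsetI)
  fix y assume "y \<in> range (\<lambda>x. L (p x))"
  then obtain x where y: "y = L (p x)" by blast
  then have "p y = y" by (simp add: p_simps flip: L_p)
  moreover have "K y = y" using y K_L by simp
  ultimately show "y \<in> {x \<in> range p. q x = 0}"
    using fixed_K_kernel by (auto simp: projectionD(5)[OF p])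
next
  fix y assume "y \<in> {x \<in> range p. q x = 0}"
  then have "p y = y" "K y = y"
    using fixed_K_kernel by (auto simp: projectionD(5)[OF p])
  then have "y = L (p y)" using L_fixed by simp
  then show "y \<in> range (\<lambda>x. L (p x))" by blast
qed

lemma summable_D: "summable (\<lambda>k. (norm (D (e k)))\<^sup>2)"
  using hs by (simp add: D_def)

lemma p_Dn_hs: "summable (\<lambda>k. (norm (p ((D ^^ Suc n) (e k))))\<^sup>2)"
proof (rule summable_comparison_test'[OF summable_D])
  fix k
  have "norm (p ((D ^^ Suc n) (e k))) \<le> norm (D (e k))"
    using norm_Dn_antimono[of 1 "Suc n" "e k"] projectionD(7)[OF p, of "(D ^^ Suc n) (e k)"] by simp
  then show "norm ((norm (p ((D ^^ Suc n) (e k))))\<^sup>2) \<le> (norm (D (e k)))\<^sup>2"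
    by (simp add: power_mono)
qed

lemma Dn_p_hs: "summable (\<lambda>k. (norm ((D ^^ Suc n) (p (e k))))\<^sup>2)"
proof (rule hilbert_schmidt_adjoint[OF e _ p_Dn_hs[of n]])
  show "cinner (p ((D ^^ Suc n) x)) y = cinner x ((D ^^ Suc n) (p y))" for x y
    by (simp only: selfadjointD(2)[OF projectionD(1)[OF p]] Dn_cinner)
qed

text \<open>
  \<open>tr n\<close> is the trace of \<open>K\<^sup>n\<^sup>+\<^sup>1 p\<close>, as \<open>K\<close> is the square of the selfadjoint \<open>D\<close>. The shift by one excludes
  the power \<open>0\<close>, for which the sum would be the trace of \<open>p\<close>, in general infinite.
\<close>

definition tr :: "nat \<Rightarrow> real" where
  "tr n = (\<Sum>k. (norm ((D ^^ Suc n) (p (e k))))\<^sup>2)"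

text \<open>
  The decrement is the trace of \<open>K\<^sup>n\<^sup>+\<^sup>1 p q p\<close>. Moving the factors to the other side of the inner
  product by cyclicity makes it symmetric in \<open>p\<close> and \<open>q\<close>, up to the sign of \<open>D\<close>.
\<close>

lemma tr_diff: "tr n - tr (Suc n) = (\<Sum>k. inner (q ((D ^^ Suc n) (e k))) (p ((D ^^ Suc n) (e k))))"
proof -
  let ?d = "D ^^ Suc n"
  have inner_d: "inner (?d x) (?d y) = inner ((K ^^ Suc n) x) y" for x y
    by (metis Dn_inner Dn_Dn)
  have "(norm (?d (p x)))\<^sup>2 - (norm ((D ^^ Suc (Suc n)) (p x)))\<^sup>2 = inner (?d (q (p x))) (?d (p x))" for x
  proof -
    have "(D ^^ Suc (Suc n)) (p x) = ?d (D (p x))"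
      by (simp only: funpow_swap1 funpow.simps comp_apply)
    then have "(norm ((D ^^ Suc (Suc n)) (p x)))\<^sup>2 = inner ((K ^^ Suc n) (D (p x))) (D (p x))"
      by (simp add: power2_norm_eq_inner inner_d del: funpow.simps)
    also have "\<dots> = inner ((K ^^ Suc n) (p x)) (K (p x))"
    proof -
      have "(K ^^ Suc n) (D (p x)) = D ((K ^^ Suc n) (p x))"
        unfolding K_funpow by (rule funpow_swap1[symmetric])
      then show ?thesis using Dn_inner[of 1] by (simp add: K_def)
    qed
    finally have "(norm (?d (p x)))\<^sup>2 - (norm ((D ^^ Suc (Suc n)) (p x)))\<^sup>2
        = inner ((K ^^ Suc n) (p x)) (p (q (p x)))"
      unfolding K_p(2) by (simp add: power2_norm_eq_inner inner_d inner_diff_right del: funpow.simps)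
    also have "\<dots> = inner ((K ^^ Suc n) (p x)) (q (p x))"
      unfolding p_inner[symmetric] Kn_p p_simps ..
    also have "\<dots> = inner (?d (q (p x))) (?d (p x))"
      by (metis inner_d inner_commute)
    finally show ?thesis .
  qed
  then have "tr n - tr (Suc n) = (\<Sum>k. inner (?d (q (p (e k)))) (?d (p (e k))))"
    unfolding tr_def suminf_diff[OF Dn_p_hs Dn_p_hs] by simp
  also have "\<dots> = (\<Sum>k. inner (p (q (?d (e k)))) (p (?d (e k))))"
  proof (rule hilbert_schmidt_adjoint_inner[OF e])
    have adj: "cinner (?d (q (p x))) y = cinner x (p (q (?d y)))" for x y
      by (simp only: selfadjointD(2)[OF projectionD(1)[OF p]] selfadjointD(2)[OF projectionD(1)[OF q]] Dn_cinner)
    then show "cinner (?d (q (p x))) y = cinner x (p (q (?d y)))" for x y .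
    show "cinner (?d (p x)) y = cinner x (p (?d y))" for x y
      by (simp only: selfadjointD(2)[OF projectionD(1)[OF p]] Dn_cinner)
    show "summable (\<lambda>k. (norm (?d (p (e k))))\<^sup>2)"
      by (rule Dn_p_hs)
    have "summable (\<lambda>k. (norm (p (q (?d (e k)))))\<^sup>2)"
    proof (rule summable_comparison_test'[OF summable_D])
      fix k
      have "norm (p (q (?d (e k)))) \<le> norm (?d (e k))"
        using projectionD(7)[OF p] projectionD(7)[OF q] order_trans by blast
      also have "\<dots> \<le> norm (D (e k))"
        using norm_Dn_antimono[of 1 "Suc n" "e k"] by simp
      finally show "norm ((norm (p (q (?d (e k)))))\<^sup>2) \<le> (norm (D (e k)))\<^sup>2"
        by (simp add: power_mono)
    qed
    then show "summable (\<lambda>k. (norm (?d (q (p (e k)))))\<^sup>2)"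
      by (rule hilbert_schmidt_adjoint(1)[OF e, rotated])
         (simp only: selfadjointD(2)[OF projectionD(1)[OF p]] selfadjointD(2)[OF projectionD(1)[OF q]] Dn_cinner)
  qed
  also have "\<dots> = (\<Sum>k. inner (q (?d (e k))) (p (?d (e k))))"
    by (simp only: p_inner p_simps)
  finally show ?thesis .
qed

lemma tr_limit:
  "(\<lambda>n. tr (Suc (2 * n))) \<longlonglongrightarrow> (\<Sum>k. (norm (L (p (e k))))\<^sup>2)"
  and summable_Lp: "summable (\<lambda>k. (norm (L (p (e k))))\<^sup>2)"
proof -
  have tr: "tr (Suc (2 * n)) = (\<Sum>k. (norm ((K ^^ Suc n) (p (e k))))\<^sup>2)" for n
    unfolding tr_def K_funpow by simp
  have 1: "(\<lambda>n. (norm ((K ^^ Suc n) (p (e k))))\<^sup>2) \<longlonglongrightarrow> (norm (L (p (e k))))\<^sup>2" for k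
    by (intro tendsto_intros LIMSEQ_Suc Kn_tendsto)
  have 2: "\<bar>(norm ((K ^^ Suc n) (p (e k))))\<^sup>2\<bar> \<le> (norm (D (p (e k))))\<^sup>2" for k n
    using norm_Kn_le_D by (simp add: power_mono del: funpow.simps)
  have 3: "summable (\<lambda>k. (norm (D (p (e k))))\<^sup>2)"
    using Dn_p_hs[of 0] by simp
  show "(\<lambda>n. tr (Suc (2 * n))) \<longlonglongrightarrow> (\<Sum>k. (norm (L (p (e k))))\<^sup>2)"
    unfolding tr by (rule dominated_suminf_tendsto(1)[OF 1 2 3])
  show "summable (\<lambda>k. (norm (L (p (e k))))\<^sup>2)"
    by (rule dominated_suminf_tendsto(2)[OF 1 2 3])
qed

lemma kernel_dim:
  "finite_cdim {x \<in> range p. q x = 0}"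
  "real (cvec.dim {x \<in> range p. q x = 0}) = (\<Sum>k. (norm (L (p (e k))))\<^sup>2)"
  using projection_dim_eq_trace[OF projection_Lp e summable_Lp] unfolding range_Lp by auto

text \<open>
  \<open>K\<^sup>m\<close> converges to \<open>L\<close> even in Hilbert-Schmidt norm, by dominated convergence over the basis. So some
  \<open>K\<^sup>m\<close> has norm at most \<open>1/2\<close> on the kernel of \<open>L\<close>, where then
  \<open>\<parallel>x\<parallel> \<le> 2 \<parallel>x - K\<^sup>m x\<parallel> \<le> 2 m \<parallel>x - K x\<parallel>\<close>. On \<open>ran p\<close> the last vector is \<open>p q x\<close>.
\<close>

lemma bounded_below:
  obtains c where "c > 0" "\<And>x. p x = x \<Longrightarrow> L x = 0 \<Longrightarrow> c * norm x \<le> norm (q x)"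
proof -
  let ?A = "\<lambda>n x. (K ^^ Suc n) x - L x"
  have A_le: "(norm (?A n x))\<^sup>2 \<le> 4 * (norm (D x))\<^sup>2" for n x
  proof -
    have "norm (?A n x) \<le> 2 * norm (D x)"
      using norm_Kn_le_D[of n x] norm_L_le_D[of x] norm_triangle_ineq4[of "(K ^^ Suc n) x" "L x"] by simp
    then show ?thesis using power_mono[of "norm (?A n x)" "2 * norm (D x)" 2] by (simp add: power_mult_distrib)
  qed
  have sm4: "summable (\<lambda>k. 4 * (norm (D (e k)))\<^sup>2)"
    by (intro summable_mult summable_D)
  have lim: "(\<lambda>n. (norm (?A n x))\<^sup>2) \<longlonglongrightarrow> 0" for x
    using tendsto_power[OF tendsto_norm[OF tendsto_diff[OF LIMSEQ_Suc[OF Kn_tendsto[of x]] tendsto_const[of "L x"]]], of 2]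
    by simp
  have "(\<lambda>n. \<Sum>k. (norm (?A n (e k)))\<^sup>2) \<longlonglongrightarrow> (\<Sum>k. 0)"
    by (rule dominated_suminf_tendsto(1)[OF lim _ sm4]) (use A_le in \<open>simp del: funpow.simps\<close>)
  then have "\<forall>\<^sub>F n in sequentially. (\<Sum>k. (norm (?A n (e k)))\<^sup>2) < 1 / 4"
    by (intro order_tendstoD) auto
  then obtain n where n: "(\<Sum>k. (norm (?A n (e k)))\<^sup>2) < 1 / 4"
    by (auto simp: eventually_sequentially)
  let ?m = "Suc n"
  have half: "norm ((K ^^ ?m) x) \<le> norm x / 2" if "L x = 0" for x
  proof (rule power2_le_imp_le)
    have "(norm (?A n x))\<^sup>2 \<le> (\<Sum>k. (norm (?A n (e k)))\<^sup>2) * (norm x)\<^sup>2"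
    proof (rule hilbert_schmidt_norm_bound[OF e])
      show "cinner (?A n x) y = cinner x (?A n y)" for x y
        by (simp add: cinner_diff_left cinner_diff_right Kn_cinner
            selfadjointD(2)[OF projectionD(1)[OF projection_L]] del: funpow.simps)
      show "summable (\<lambda>k. (norm (?A n (e k)))\<^sup>2)"
        by (rule summable_comparison_test'[OF sm4]) (use A_le in \<open>simp del: funpow.simps\<close>)
    qed
    also have "\<dots> \<le> 1 / 4 * (norm x)\<^sup>2"
      using n by (intro mult_right_mono) auto
    finally show "(norm ((K ^^ ?m) x))\<^sup>2 \<le> (norm x / 2)\<^sup>2"
      by (simp add: that power_divide)
  qed simp
  have telescope: "norm (x - (K ^^ m) x) \<le> real m * norm (x - K x)" for m x
  proof (induction m)
    case (Suc m)
    have "x - (K ^^ Suc m) x = (x - (K ^^ m) x) + (K ^^ m) (x - K x)"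
      by (simp add: Kn_simps funpow_swap1)
    then have "norm (x - (K ^^ Suc m) x) \<le> norm (x - (K ^^ m) x) + norm ((K ^^ m) (x - K x))"
      using norm_triangle_ineq by metis
    also have "\<dots> \<le> real m * norm (x - K x) + norm (x - K x)"
      by (intro add_mono Suc Kn_le)
    finally show ?case by (simp add: algebra_simps)
  qed simp
  have "(1 / (2 * real ?m)) * norm x \<le> norm (q x)" if x: "p x = x" "L x = 0" for x
  proof -
    have "norm x \<le> norm (x - (K ^^ ?m) x) + norm ((K ^^ ?m) x)"
      using norm_triangle_ineq[of "x - (K ^^ ?m) x" "(K ^^ ?m) x"] by simp
    also have "\<dots> \<le> real ?m * norm (x - K x) + norm x / 2"
      by (intro add_mono telescope half x)
    finally have "norm x \<le> 2 * (real ?m * norm (x - K x))"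
      by linarith
    then have "norm x \<le> 2 * real ?m * norm (x - K x)"
      by (simp only: mult.assoc)
    also have "x - K x = p (q x)"
      using K_p(2)[of x] x(1) by simp
    also have "2 * real ?m * norm (p (q x)) \<le> 2 * real ?m * norm (q x)"
      by (intro mult_left_mono projectionD(7)[OF p]) simp
    finally show ?thesis
      by (simp add: field_simps)
  qed
  then show thesis
    by (intro that[of "1 / (2 * real ?m)"]) auto
qed

text \<open>
  Splitting off the kernel \<open>ran (L p)\<close> does not change the image, and on the orthogonal complement
  \<open>q\<close> is bounded below.
\<close>

lemma closed_image: "closed (q ` range p)"
proof -
  define V where "V = {x. p x = x \<and> L x = 0}"
  have V: "V = {x. p x = x} \<inter> {x. L x = 0}" by (auto simp: V_def)
  note blL = bounded_clinearD(1)[OF projectionD(2)[OF projection_L]]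
  obtain c where c: "c > 0" "\<And>x. p x = x \<Longrightarrow> L x = 0 \<Longrightarrow> c * norm x \<le> norm (q x)"
    using bounded_below by blast
  have "closed V"
    unfolding V
    by (intro closed_Int closed_Collect_eq bounded_linear.continuous_on[OF p_simps(1)]
        bounded_linear.continuous_on[OF blL] continuous_intros)
  then have "complete V" by (simp add: complete_eq_closed)
  moreover have "subspace V"
    unfolding subspace_def V_def
    by (auto simp: p_simps bounded_clinearD[OF projectionD(2)[OF projection_L]])
  ultimately have "complete (q ` V)"
    using c by (intro complete_isometric_image[of c V q] q_simps(1)) (auto simp: V_def)
  moreover have "q ` range p = q ` V"
  proof (intro equalityI subsetI)
    fix y assume "y \<in> q ` range p"
    then obtain x where x: "y = q x" "p x = x" using projectionD(5)[OF p] by auto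
    have "q (L x) = 0"
      using range_Lp x(2) by (metis (mono_tags, lifting) mem_Collect_eq rangeI)
    then have "y = q (x - L x)"
      using x by (simp add: q_simps)
    moreover have "x - L x \<in> V"
      using x by (simp add: V_def p_simps bounded_clinearD(4)[OF projectionD(2)[OF projection_L]]
          projectionD(3)[OF projection_L] flip: L_p)
    ultimately show "y \<in> q ` V" by blast
  next
    fix y assume "y \<in> q ` V"
    then show "y \<in> q ` range p" unfolding V_def using projectionD(5)[OF p] by auto
  qed
  ultimately show ?thesis by (simp add: complete_imp_closed)
qed

lemma adjoint_on_eq:
  assumes "y \<in> range q" shows "adjoint_on (range p) (range q) q y = p y"
  unfolding adjoint_on_def
proof (rule the_equality)
  have y: "q y = y" using assms by (simp add: projectionD(5)[OF q])
  have eq: "cinner (q x) y = cinner x (p y)" if "x \<in> range p" for x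
    using that y selfadjointD(2)[OF projectionD(1)[OF q], of x y] selfadjointD(2)[OF projectionD(1)[OF p], of x y]
    by (simp add: projectionD(5)[OF p])
  then show "p y \<in> range p \<and> (\<forall>x\<in>range p. cinner (q x) y = cinner x (p y))" by blast
  fix u assume u: "u \<in> range p \<and> (\<forall>x\<in>range p. cinner (q x) y = cinner x u)"
  have w: "u - p y \<in> range p"
    using u by (auto simp: projectionD(5)[OF p] p_simps)
  then have "cinner (q (u - p y)) y = cinner (u - p y) u"
    using u by blast
  then have "cinner (u - p y) (u - p y) = 0"
    using eq[OF w] by (simp add: cinner_diff_right)
  then show "u = p y" by (simp add: cinner_self)
qed

lemma kernels:
  "ker_on (range p) q = {x \<in> range p. q x = 0}"
  "ker_on (range q) (adjoint_on (range p) (range q) q) = {x \<in> range q. p x = 0}"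
  by (auto simp: ker_on_def adjoint_on_eq)

lemma fredholm: "fredholm_pair p q"
proof -
  interpret S: hs_projection_pair q p e by (rule swap)
  have "bounded_op (range p) (range q) q"
    unfolding bounded_op_def
    using projection_range_closed_subspace[OF p] projection_range_closed_subspace[OF q]
      projectionD(7)[OF q]
    by (auto simp: q_simps intro!: exI[of _ 1])
  then show ?thesis
    unfolding fredholm_pair_def fredholm_on_def kernels
    using p q closed_image kernel_dim(1) S.kernel_dim(1) by simp
qed

text \<open>
  The sequences of traces \<open>tr(K\<^sup>n p)\<close> and \<open>tr(K\<^sup>n q)\<close> have the same decrements, so that their
  difference is constant. Its first term is the left-hand side, its limit the index.
\<close>

lemma index_formula:
  "(\<Sum>k. (norm (p (e k) - p (q (e k))))\<^sup>2) - (\<Sum>k. (norm (p (q (e k)) - q (e k)))\<^sup>2)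
     = real_of_int (essential_codim p q)"
proof -
  interpret S: hs_projection_pair q p e by (rule swap)
  have SD: "S.D x = - D x" for x
    by (simp add: D_def S.D_def)
  have SDn: "(S.D ^^ n) x = (-1) ^ n *\<^sub>R (D ^^ n) x" for n x
    by (induction n) (simp_all add: SD bounded_clinearD[OF bounded_clinear_D])
  have decr: "tr n - tr (Suc n) = S.tr n - S.tr (Suc n)" for n
    unfolding tr_diff S.tr_diff SDn
    by (simp add: p_simps q_simps inner_commute del: funpow.simps flip: power_mult_distrib mult.assoc)
  have const: "tr n - S.tr n = tr 0 - S.tr 0" for n
  proof (induction n)
    case (Suc n)
    then show ?case using decr[of n] by linarith
  qed simp
  have "(\<lambda>n. tr (Suc (2 * n)) - S.tr (Suc (2 * n))) \<longlonglongrightarrow>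
      (\<Sum>k. (norm (L (p (e k))))\<^sup>2) - (\<Sum>k. (norm (S.L (q (e k))))\<^sup>2)"
    by (intro tendsto_diff tr_limit S.tr_limit)
  then have "tr 0 - S.tr 0 = (\<Sum>k. (norm (L (p (e k))))\<^sup>2) - (\<Sum>k. (norm (S.L (q (e k))))\<^sup>2)"
    unfolding const[of "Suc _"] by (simp add: LIMSEQ_const_iff)
  also have "\<dots> = real_of_int (essential_codim p q)"
    unfolding essential_codim_def fredholm_index_def kernels
    by (simp flip: kernel_dim(2) S.kernel_dim(2))
  finally have "tr 0 - S.tr 0 = real_of_int (essential_codim p q)" .
  moreover have "tr 0 = (\<Sum>k. (norm (p (e k) - p (q (e k))))\<^sup>2)"
  proof -
    have "cinner (D (p x)) y = cinner x (p (D y))" for x y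
      by (simp only: selfadjointD(2)[OF selfadjoint_D] selfadjointD(2)[OF projectionD(1)[OF p]])
    moreover have "summable (\<lambda>k. (norm (D (p (e k))))\<^sup>2)"
      using Dn_p_hs[of 0] by simp
    ultimately have "(\<Sum>k. (norm (D (p (e k))))\<^sup>2) = (\<Sum>k. (norm (p (D (e k))))\<^sup>2)"
      by (rule hilbert_schmidt_adjoint(2)[OF e])
    then show ?thesis by (simp add: tr_def) (simp add: D_def p_simps)
  qed
  moreover have "S.tr 0 = (\<Sum>k. (norm (p (q (e k)) - q (e k)))\<^sup>2)"
    by (simp add: S.tr_def SD) (simp add: D_def q_simps)
  ultimately show ?thesis by simp
qed

end

section \<open>Sums along the diagonal\<close>

text \<open>
  As the negative part of \<open>g\<close> is dominated by the summable \<open>c\<close>, either \<open>g\<close> is summable or its finite partial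
  sums tend to \<open>\<infinity>\<close>. In both cases the infinite sum of extended reals is a genuine limit, not the
  default value \<open>0\<close> that stands for divergence.
\<close>

lemma infsum_ereal_real_or_infinity:
  fixes g c :: "'b \<Rightarrow> real"
  assumes c: "c summable_on S" and pos: "\<And>k. k \<in> S \<Longrightarrow> c k \<ge> 0" "\<And>k. k \<in> S \<Longrightarrow> g k + c k \<ge> 0"
  shows "((\<lambda>k. g k + c k) summable_on S \<and> g summable_on S \<and>
          (\<Sum>\<^sub>\<infinity>k\<in>S. ereal (g k)) = ereal (\<Sum>\<^sub>\<infinity>k\<in>S. g k)) \<or>
         (\<Sum>\<^sub>\<infinity>k\<in>S. ereal (g k)) = \<infinity>"
proof (cases "(\<lambda>k. g k + c k) summable_on S")
  case True
  then have g: "g summable_on S"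
    using summable_on_add[OF True summable_on_uminus[THEN iffD2, OF c]] by simp
  then have "(sum g \<longlongrightarrow> (\<Sum>\<^sub>\<infinity>k\<in>S. g k)) (finite_subsets_at_top S)"
    using has_sum_infsum unfolding has_sum_def by blast
  then have "((\<lambda>F. ereal (sum g F)) \<longlongrightarrow> ereal (\<Sum>\<^sub>\<infinity>k\<in>S. g k)) (finite_subsets_at_top S)"
    by (rule tendsto_ereal)
  moreover have "(\<lambda>F. ereal (sum g F)) = sum (\<lambda>k. ereal (g k))"
    by (simp add: fun_eq_iff)
  ultimately have "((\<lambda>k. ereal (g k)) has_sum ereal (\<Sum>\<^sub>\<infinity>k\<in>S. g k)) S"
    unfolding has_sum_def by metis
  then show ?thesis using g True infsumI by blast
next
  case False
  have "((\<lambda>k. ereal (g k)) has_sum \<infinity>) S"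
    unfolding has_sum_def tendsto_PInfty
  proof
    fix r
    obtain F where F: "F \<subseteq> S" "finite F" "(\<Sum>k\<in>F. g k + c k) > r + (\<Sum>\<^sub>\<infinity>k\<in>S. c k)"
    proof (rule ccontr)
      assume "\<not> thesis"
      then have "(\<Sum>k\<in>F. g k + c k) \<le> r + (\<Sum>\<^sub>\<infinity>k\<in>S. c k)" if "F \<subseteq> S" "finite F" for F
        using that \<open>\<And>F. \<lbrakk>F \<subseteq> S; finite F; r + infsum c S < (\<Sum>k\<in>F. g k + c k)\<rbrakk> \<Longrightarrow> thesis\<close>
        by (meson not_le)
      then have "bdd_above (sum (\<lambda>k. g k + c k) ` {F. F \<subseteq> S \<and> finite F})"
        by (intro bdd_aboveI2[where M = "r + (\<Sum>\<^sub>\<infinity>k\<in>S. c k)"]) auto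
      then have "(\<lambda>k. g k + c k) summable_on S"
        by (intro nonneg_bdd_above_summable_on pos(2))
      then show False using False by blast
    qed
    show "\<forall>\<^sub>F H in finite_subsets_at_top S. ereal r < (\<Sum>k\<in>H. ereal (g k))"
      unfolding eventually_finite_subsets_at_top
    proof (intro exI[of _ F] conjI F allI impI)
      fix H assume H: "finite H \<and> F \<subseteq> H \<and> H \<subseteq> S"
      have "(\<Sum>k\<in>F. g k + c k) \<le> (\<Sum>k\<in>H. g k + c k)"
        using H pos(2) by (intro sum_mono2) auto
      moreover have "(\<Sum>k\<in>H. c k) \<le> (\<Sum>\<^sub>\<infinity>k\<in>S. c k)"
        using H pos(1) c by (intro finite_sum_le_infsum) auto
      ultimately have "r < (\<Sum>k\<in>H. g k)"
        using F(3) by (simp add: sum.distrib)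
      then show "ereal r < (\<Sum>k\<in>H. ereal (g k))" by simp
    qed
  qed
  then show ?thesis using infsumI by blast
qed

lemma has_sum_finite_sum:
  fixes f :: "'j \<Rightarrow> 'b \<Rightarrow> 'c::topological_comm_monoid_add"
  assumes "finite J" "\<And>j. j \<in> J \<Longrightarrow> (f j has_sum s j) S"
  shows "((\<lambda>k. \<Sum>j\<in>J. f j k) has_sum (\<Sum>j\<in>J. s j)) S"
  using assms by (induction J rule: finite_induct) (auto intro: has_sum_add)

text \<open>
  Once the terms with negative weight are known to be summable, a finite sum of \<open>g\<close> forces
  summability of each \<open>x j\<close> whose weight is positive. For \<open>w j = 0\<close> the sum of \<open>x j\<close> may be a default
  value, which is multiplied by \<open>0\<close>.
\<close>

lemma infsum_ereal_combination:
  fixes x :: "'j \<Rightarrow> 'b \<Rightarrow> real" and w :: "'j \<Rightarrow> real"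
  assumes J: "finite J" and x: "\<And>j k. x j k \<ge> 0"
    and g: "\<And>k. g k = (\<Sum>j\<in>J. w j * x j k)"
    and neg: "\<And>j. j \<in> J \<Longrightarrow> w j < 0 \<Longrightarrow> x j summable_on S"
    and fin: "(\<Sum>\<^sub>\<infinity>k\<in>S. ereal (g k)) \<noteq> \<infinity>"
  shows "\<And>j. j \<in> J \<Longrightarrow> w j \<noteq> 0 \<Longrightarrow> x j summable_on S"
    and "(\<Sum>\<^sub>\<infinity>k\<in>S. ereal (g k)) = ereal (\<Sum>j\<in>J. w j * (\<Sum>\<^sub>\<infinity>k\<in>S. x j k))"
proof -
  define c where "c k = (\<Sum>j\<in>J. (if w j < 0 then - w j else 0) * x j k)" for k
  have c: "c summable_on S"
  proof -
    have "(\<lambda>k. (if w j < 0 then - w j else 0) * x j k) summable_on S" if "j \<in> J" for j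
      using summable_on_cmult_right[OF neg[OF that], of "- w j"] by (cases "w j < 0") auto
    then show ?thesis
      unfolding c_def by (intro has_sum_imp_summable[OF has_sum_finite_sum[OF J has_sum_infsum]])
  qed
  have gc: "g k + c k = (\<Sum>j\<in>J. max 0 (w j) * x j k)" for k
    unfolding g c_def sum.distrib[symmetric] by (intro sum.cong) auto
  have pos: "c k \<ge> 0" "g k + c k \<ge> 0" for k
    unfolding gc by (auto simp: c_def intro!: sum_nonneg mult_nonneg_nonneg x)
  have gsm: "g summable_on S" "(\<lambda>k. g k + c k) summable_on S"
    and geq: "(\<Sum>\<^sub>\<infinity>k\<in>S. ereal (g k)) = ereal (\<Sum>\<^sub>\<infinity>k\<in>S. g k)"
    using infsum_ereal_real_or_infinity[OF c pos] fin by blast+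
  show sm: "x j summable_on S" if j: "j \<in> J" "w j \<noteq> 0" for j
  proof (cases "w j < 0")
    case False
    then have w: "w j > 0" using j by simp
    have "(\<lambda>k. w j * x j k) summable_on S"
    proof (rule summable_on_comparison_test[OF gsm(2)])
      fix k assume "k \<in> S"
      have "max 0 (w j) * x j k \<le> g k + c k"
        unfolding gc using J j by (intro member_le_sum) (auto intro!: mult_nonneg_nonneg x)
      then show "w j * x j k \<le> g k + c k" using w by simp
    qed (use w x in auto)
    then show ?thesis
      using w summable_on_cmult_right'[of "w j" "x j" S] by simp
  qed (use neg j in auto)
  have "((\<lambda>k. w j * x j k) has_sum w j * (\<Sum>\<^sub>\<infinity>k\<in>S. x j k)) S" if "j \<in> J" for j
    using sm[OF that] by (cases "w j = 0") (auto intro: has_sum_cmult_right has_sum_infsum)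
  then have "(g has_sum (\<Sum>j\<in>J. w j * (\<Sum>\<^sub>\<infinity>k\<in>S. x j k))) S"
    unfolding g by (rule has_sum_finite_sum[OF J])
  then show "(\<Sum>\<^sub>\<infinity>k\<in>S. ereal (g k)) = ereal (\<Sum>j\<in>J. w j * (\<Sum>\<^sub>\<infinity>k\<in>S. x j k))"
    unfolding geq by (simp add: infsumI)
qed

text \<open>
  Since \<open>d k\<close> and \<open>1 - d k\<close> are combinations of the \<open>x j k\<close> with weights \<open>a j\<close> and \<open>1 - a j\<close>, every
  \<open>j\<close> other than \<open>i0\<close> and \<open>i1\<close> contributes \<open>a j u - (1 - a j) v - a j (u + v) = - v\<close> to the final
  formula, where \<open>u\<close> and \<open>v\<close> are the sums of \<open>x j\<close> over \<open>S\<close> and its complement.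

  The weights \<open>a j\<close> below 0 and above 1 are harmless because \<open>x j\<close> is summable for them. Hence on
  \<open>S\<close> finiteness of the sum of the \<open>d k\<close> forces summability of \<open>x j\<close> whenever \<open>a j \<noteq> 0\<close>, and on
  the complement of \<open>S\<close> finiteness of the sum of the \<open>1 - d k\<close> does so whenever \<open>a j \<noteq> 1\<close>.
\<close>

lemma diagonal_sums:
  fixes a :: "'j \<Rightarrow> real" and x :: "'j \<Rightarrow> nat \<Rightarrow> real" and S :: "nat set"
  assumes J: "finite J" "i0 \<in> J" "i1 \<in> J"
    and a0: "\<And>j. j \<in> J \<Longrightarrow> a j = 0 \<longleftrightarrow> j = i0" and a1: "\<And>j. j \<in> J \<Longrightarrow> a j = 1 \<longleftrightarrow> j = i1"
    and x: "\<And>j k. x j k \<ge> 0" "\<And>k. (\<Sum>j\<in>J. x j k) = 1"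
    and d: "\<And>k. d k = (\<Sum>j\<in>J. a j * x j k)"
    and out: "\<And>j. j \<in> J \<Longrightarrow> a j < 0 \<or> a j > 1 \<Longrightarrow> x j summable_on UNIV"
    and fin: "(\<Sum>\<^sub>\<infinity>k\<in>S. ereal (d k)) + (\<Sum>\<^sub>\<infinity>k\<in>-S. ereal (1 - d k)) < \<infinity>"
  shows "\<And>j. j \<in> J \<Longrightarrow> j \<noteq> i0 \<Longrightarrow> x j summable_on S"
    and "\<And>j. j \<in> J \<Longrightarrow> j \<noteq> i1 \<Longrightarrow> x j summable_on -S"
    and "(\<Sum>\<^sub>\<infinity>k\<in>S. ereal (d k)) - (\<Sum>\<^sub>\<infinity>k\<in>-S. ereal (1 - d k))
           - ereal (\<Sum>j\<in>J - {i1}. a j * (\<Sum>\<^sub>\<infinity>k. x j k))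
         = ereal ((\<Sum>\<^sub>\<infinity>k\<in>S. x i1 k) - (\<Sum>j\<in>J - {i1}. \<Sum>\<^sub>\<infinity>k\<in>-S. x j k))"
proof -
  let ?A = "\<Sum>\<^sub>\<infinity>k\<in>S. ereal (d k)" and ?B = "\<Sum>\<^sub>\<infinity>k\<in>-S. ereal (1 - d k)"
  let ?u = "\<lambda>j. \<Sum>\<^sub>\<infinity>k\<in>S. x j k" and ?v = "\<lambda>j. \<Sum>\<^sub>\<infinity>k\<in>-S. x j k"
  have d1: "1 - d k = (\<Sum>j\<in>J. (1 - a j) * x j k)" for k
    by (simp add: left_diff_distrib sum_subtractf x(2) d)
  have out': "x j summable_on T" if "j \<in> J" "a j < 0 \<or> a j > 1" for j T
    using out[OF that] summable_on_subset_banach by blast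
  have "?A \<noteq> \<infinity>" "?B \<noteq> \<infinity>"
    using fin by auto
  have outA: "x j summable_on S" if "j \<in> J" "a j < 0" for j
    using that out' by blast
  have outB: "x j summable_on -S" if "j \<in> J" "1 - a j < 0" for j
    using that out' by auto
  note A = infsum_ereal_combination[OF J(1) x(1) d outA \<open>?A \<noteq> \<infinity>\<close>]
  note B = infsum_ereal_combination[OF J(1) x(1) d1 outB \<open>?B \<noteq> \<infinity>\<close>]
  show u: "x j summable_on S" if "j \<in> J" "j \<noteq> i0" for j
    using A(1)[of j] a0 that by auto
  show v: "x j summable_on -S" if "j \<in> J" "j \<noteq> i1" for j
    using B(1)[of j] a1 that by auto
  have t: "(\<Sum>\<^sub>\<infinity>k. x j k) = ?u j + ?v j" if "j \<in> J" "j \<noteq> i0" "j \<noteq> i1" for j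
    using infsum_Un_disjoint[OF u[of j] v[of j]] that by simp
  have "(\<Sum>j\<in>J. a j * ?u j) - (\<Sum>j\<in>J. (1 - a j) * ?v j) - (\<Sum>j\<in>J - {i1}. a j * (\<Sum>\<^sub>\<infinity>k. x j k))
      = ?u i1 + (\<Sum>j\<in>J - {i1}. a j * ?u j - (1 - a j) * ?v j - a j * (\<Sum>\<^sub>\<infinity>k. x j k))"
    using J a1[of i1] by (simp add: sum.remove[of J i1] sum_subtractf)
  also have "(\<Sum>j\<in>J - {i1}. a j * ?u j - (1 - a j) * ?v j - a j * (\<Sum>\<^sub>\<infinity>k. x j k)) = (\<Sum>j\<in>J - {i1}. - ?v j)"
  proof (rule sum.cong)
    fix j assume j: "j \<in> J - {i1}"
    show "a j * ?u j - (1 - a j) * ?v j - a j * (\<Sum>\<^sub>\<infinity>k. x j k) = - ?v j"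
    proof (cases "j = i0")
      case True
      then show ?thesis using a0[of i0] J(2) by simp
    next
      case False
      then show ?thesis using t[of j] j by (simp add: algebra_simps)
    qed
  qed simp
  finally show "?A - ?B - ereal (\<Sum>j\<in>J - {i1}. a j * (\<Sum>\<^sub>\<infinity>k. x j k))
      = ereal (?u i1 - (\<Sum>j\<in>J - {i1}. ?v j))"
    using A(2) B(2) by (simp add: sum_negf)
qed

section \<open>The index formula\<close>

theorem mainTheorem2:
  fixes z :: "'a::complex_hilbert_space \<Rightarrow> 'a"
    and m n r :: nat
    and a :: "int \<Rightarrow> real"
    and p :: "int \<Rightarrow> 'a \<Rightarrow> 'a"
    and e :: "nat \<Rightarrow> 'a"
    and d :: "nat \<Rightarrow> real"
    and q :: "'a \<Rightarrow> 'a"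
    and A B :: ereal
  assumes "separable_space (euclidean :: 'a topology)"
    and "\<not> finite_cdim (UNIV :: 'a set)"
    and "selfadjoint z"
    and "r \<ge> 1"
    and "strict_mono_on {- int m..int n + int r} a"
    and "spectrum z = (\<lambda>j. complex_of_real (a j)) ` {- int m..int n + int r}"
    and "\<And>j. j \<in> {- int m..int n + int r} \<Longrightarrow>
           p j = func_calc z (indicator {complex_of_real (a j)})"
    and "a 0 = 0"
    and "a (int n + 1) = 1"
    and "\<And>j. j \<in> {- int m..int n + int r} \<Longrightarrow> j < 0 \<or> j > int n + 1 \<Longrightarrow> Tr (p j) < \<infinity>"
    and "orthonormal_basis e"
    and "\<And>k. complex_of_real (d k) = cinner (z (e k)) (e k)"
    and "A = (\<Sum>\<^sub>\<infinity>k\<in>{k. d k \<le> 1/2}. ereal (d k))"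
    and "B = (\<Sum>\<^sub>\<infinity>k\<in>{k. d k > 1/2}. ereal (1 - d k))"
    and "q = proj_onto (closure (cvec.span {e k | k. d k > 1/2}))"
    and "A + B < \<infinity>"
  shows "(\<forall>j. 0 < j \<and> j < int n + 1 \<longrightarrow> Tr (p j) < \<infinity>) \<and>
         fredholm_pair (p (int n + 1)) q \<and>
         A - B - (\<Sum>j\<in>{- int m..int n + int r} - {int n + 1}. ereal (a j) * enn2ereal (Tr (p j)))
           = ereal (real_of_int (essential_codim (p (int n + 1)) q))"
proof -
  let ?J = "{- int m..int n + int r}" and ?i1 = "int n + 1"
  note z = assms(3) and r = assms(4) and mono = assms(5) and spec = assms(6) and e = assms(11)
  have i0: "0 \<in> ?J" and i1: "?i1 \<in> ?J" using r by auto
  have inj: "inj_on a ?J" by (rule strict_mono_on_imp_inj_on[OF mono])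
  have a_less: "a i < a j \<longleftrightarrow> i < j" if "i \<in> ?J" "j \<in> ?J" for i j
    using strict_mono_onD[OF mono that] strict_mono_onD[OF mono that(2,1)] by (cases i j rule: linorder_cases) auto
  have a0: "a j = 0 \<longleftrightarrow> j = 0" and a1: "a j = 1 \<longleftrightarrow> j = ?i1" if "j \<in> ?J" for j
    using inj_onD[OF inj _ that i0] inj_onD[OF inj _ that i1] assms(8,9) by auto

  have spec': "spectrum z = complex_of_real ` (a ` ?J)" unfolding spec by (simp add: image_image)
  have S: "finite (a ` ?J)" "a ` ?J \<noteq> {}" using i0 by auto
  note sd = spectral_decomposition[OF z S spec']
  have proj: "projection (p j)" if "j \<in> ?J" for j
    unfolding assms(7)[OF that] using that by (intro sd(1)) auto
  have reindex: "(\<Sum>s\<in>a ` ?J. f s (func_calc z (indicator {complex_of_real s}) x)) = (\<Sum>j\<in>?J. f (a j) (p j x))"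
    for f :: "real \<Rightarrow> 'a \<Rightarrow> 'a" and x
    unfolding sum.reindex[OF inj] comp_def
    by (rule sum.cong[OF refl]) (simp only: assms(7))
  have sum_p: "(\<Sum>j\<in>?J. p j x) = x" for x
    using sd(3)[of x] unfolding reindex[of "\<lambda>_ y. y"] .
  have z_eq: "z x = (\<Sum>j\<in>?J. a j *\<^sub>R p j x)" for x
    using sd(4)[of x] unfolding reindex[of "\<lambda>s y. s *\<^sub>R y"] .

  define x where "x j k = (norm (p j (e k)))\<^sup>2" for j k
  have x_inner: "x j k = inner (p j (e k)) (e k)" if "j \<in> ?J" for j k
    using projectionD(6)[OF proj[OF that], of "e k"] by (simp add: x_def)
  have norm_e: "inner (e k) (e k) = 1" for k
    using orthonormal_basisD(1)[OF e, of k k] by (simp flip: Re_cinner)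
  have sum_x: "(\<Sum>j\<in>?J. x j k) = 1" for k
  proof -
    have "(\<Sum>j\<in>?J. x j k) = inner (\<Sum>j\<in>?J. p j (e k)) (e k)"
      unfolding inner_sum_left by (intro sum.cong x_inner) auto
    then show ?thesis unfolding sum_p norm_e .
  qed
  have d_eq: "d k = (\<Sum>j\<in>?J. a j * x j k)" for k
  proof -
    have "d k = inner (z (e k)) (e k)"
      using assms(12)[of k] by (metis Re_cinner Re_complex_of_real)
    also have "\<dots> = (\<Sum>j\<in>?J. a j * x j k)"
      unfolding z_eq inner_sum_left by (rule sum.cong) (simp_all add: x_inner)
    finally show ?thesis .
  qed
  have Tr_p: "Tr (p j) = (\<Sum>k. ennreal (x j k))" if "j \<in> ?J" for j
    unfolding x_def by (rule Tr_projection[OF proj[OF that] e])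
  have Tr_fin: "Tr (p j) < \<infinity> \<longleftrightarrow> x j summable_on UNIV" if "j \<in> ?J" for j
  proof
    assume "Tr (p j) < \<infinity>"
    then have "summable (x j)"
      unfolding Tr_p[OF that] by (intro summable_suminf_not_top) (auto simp: x_def)
    then show "x j summable_on UNIV"
      by (intro summable_nonneg_imp_summable_on) (auto simp: x_def)
  next
    assume "x j summable_on UNIV"
    then have "summable (x j)" by (rule summable_on_imp_summable)
    then show "Tr (p j) < \<infinity>"
      unfolding Tr_p[OF that] by (subst suminf_ennreal2) (auto simp: x_def)
  qed
  have Tr_eq: "enn2ereal (Tr (p j)) = ereal (\<Sum>\<^sub>\<infinity>k. x j k)" if "j \<in> ?J" "x j summable_on UNIV" for j
  proof -
    have "(\<lambda>k. x j k) sums (\<Sum>\<^sub>\<infinity>k. x j k)"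
      using that(2) by (intro has_sum_imp_sums has_sum_infsum)
    then have "Tr (p j) = ennreal (\<Sum>\<^sub>\<infinity>k. x j k)"
      unfolding Tr_p[OF that(1)] by (intro suminf_ennreal_eq) (auto simp: x_def)
    then show ?thesis
      by (simp add: infsum_nonneg x_def)
  qed

  let ?S = "{k. d k \<le> 1/2}" and ?T = "{k. d k > 1/2}"
  have T: "?T = - ?S" by auto
  have out: "x j summable_on UNIV" if "j \<in> ?J" "a j < 0 \<or> a j > 1" for j
    using that(2) a_less[OF that(1) i0] a_less[OF i1 that(1)] assms(8,9) assms(10)[OF that(1)] Tr_fin[OF that(1)]
    by auto
  have fin: "(\<Sum>\<^sub>\<infinity>k\<in>?S. ereal (d k)) + (\<Sum>\<^sub>\<infinity>k\<in>-?S. ereal (1 - d k)) < \<infinity>"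
    using assms(16) unfolding assms(13,14) T .
  have x_pos: "x j k \<ge> 0" for j k by (simp add: x_def)
  note ds = diagonal_sums[of ?J 0 ?i1 a x d ?S, OF _ i0 i1 a0 a1 x_pos sum_x d_eq out fin, simplified finite_atLeastAtMost_int]
  have u: "x j summable_on ?S" if "j \<in> ?J" "j \<noteq> 0" for j
    using ds(1) that by simp
  have v: "x j summable_on ?T" if "j \<in> ?J" "j \<noteq> ?i1" for j
    using ds(2) that unfolding T by simp
  have sm: "x j summable_on UNIV" if "j \<in> ?J" "j \<noteq> 0" "j \<noteq> ?i1" for j
    using summable_on_Un_disjoint[OF u[OF that(1,2)] v[OF that(1,3)]] unfolding T by simp

  let ?p = "p ?i1"
  have q_eq: "q = proj_onto (closure (cvec.span {e k | k. k \<in> ?T}))"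
    unfolding assms(15) by simp
  have q: "projection q" and q_e: "q (e k) = (if k \<in> ?T then e k else 0)" for k
    unfolding q_eq by (rule proj_onto_basis_span[OF e])+
  \<comment> \<open>\<open>1 - p\<close> is the sum of the other spectral projections.\<close>
  have compl: "(norm (?p (e k) - e k))\<^sup>2 = (\<Sum>j\<in>?J - {?i1}. x j k)" for k
  proof -
    have "x ?i1 k + (norm (e k - ?p (e k)))\<^sup>2 = 1"
      using projectionD(8)[OF proj[OF i1], of "e k"] norm_e[of k] by (simp add: x_def power2_norm_eq_inner)
    then show ?thesis
      using sum_x[of k] sum.remove[of ?J ?i1 "\<lambda>j. x j k"] i1 by (simp add: norm_minus_commute)
  qed
  have compl_sum: "((\<lambda>k. (norm (?p (e k) - e k))\<^sup>2) has_sum (\<Sum>j\<in>?J - {?i1}. \<Sum>\<^sub>\<infinity>k\<in>?T. x j k)) ?T"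
    unfolding compl using v by (intro has_sum_finite_sum has_sum_infsum) auto
  have p_sum: "(x ?i1 has_sum (\<Sum>\<^sub>\<infinity>k\<in>?S. x ?i1 k)) ?S"
    by (intro has_sum_infsum u i1) simp
  have sum1: "(\<lambda>k. (norm (?p (e k) - ?p (q (e k))))\<^sup>2) sums (\<Sum>\<^sub>\<infinity>k\<in>?S. x ?i1 k)"
  proof (rule has_sum_imp_sums)
    show "((\<lambda>k. (norm (?p (e k) - ?p (q (e k))))\<^sup>2) has_sum (\<Sum>\<^sub>\<infinity>k\<in>?S. x ?i1 k)) UNIV"
      using p_sum
      by (rule has_sum_cong_neutral[THEN iffD1, rotated -1])
         (auto simp: x_def q_e bounded_clinearD(5)[OF projectionD(2)[OF proj[OF i1]]])
  qed
  have sum2: "(\<lambda>k. (norm (?p (q (e k)) - q (e k)))\<^sup>2) sums (\<Sum>j\<in>?J - {?i1}. \<Sum>\<^sub>\<infinity>k\<in>?T. x j k)"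
  proof (rule has_sum_imp_sums)
    show "((\<lambda>k. (norm (?p (q (e k)) - q (e k)))\<^sup>2) has_sum (\<Sum>j\<in>?J - {?i1}. \<Sum>\<^sub>\<infinity>k\<in>?T. x j k)) UNIV"
      using compl_sum
      by (rule has_sum_cong_neutral[THEN iffD1, rotated -1])
         (auto simp: q_e bounded_clinearD(5)[OF projectionD(2)[OF proj[OF i1]]])
  qed
  have "summable (\<lambda>k. (norm (?p (e k) - ?p (q (e k))))\<^sup>2 + (norm (?p (q (e k)) - q (e k)))\<^sup>2)"
    using sum1 sum2 by (intro summable_add) (auto simp: sums_iff)
  \<comment> \<open>For each \<open>k\<close> one of the two summands is \<open>0\<close>, because \<open>q e\<^sub>k\<close> is \<open>e\<^sub>k\<close> or \<open>0\<close>.\<close>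
  moreover have "(norm (?p (e k) - ?p (q (e k))))\<^sup>2 + (norm (?p (q (e k)) - q (e k)))\<^sup>2 = (norm (?p (e k) - q (e k)))\<^sup>2" for k
    by (simp add: q_e bounded_clinearD(5)[OF projectionD(2)[OF proj[OF i1]]])
  ultimately interpret hs_projection_pair ?p q e
    using proj[OF i1] q e by unfold_locales auto
  have index: "(\<Sum>\<^sub>\<infinity>k\<in>?S. x ?i1 k) - (\<Sum>j\<in>?J - {?i1}. \<Sum>\<^sub>\<infinity>k\<in>?T. x j k)
      = real_of_int (essential_codim ?p q)"
    using index_formula sum1 sum2 by (simp add: sums_iff)

  have "ereal (a j) * enn2ereal (Tr (p j)) = ereal (a j * (\<Sum>\<^sub>\<infinity>k. x j k))" if "j \<in> ?J - {?i1}" for j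
  proof (cases "j = 0")
    \<comment> \<open>\<open>Tr(p\<^sub>0)\<close> may be infinite, and then the real sum on the right is a default value; both products are \<open>0\<close>.\<close>
    case True
    then show ?thesis using assms(8) by (simp flip: zero_ereal_def)
  next
    case False
    then show ?thesis using that Tr_eq[of j] sm[of j] by simp
  qed
  then have traces: "(\<Sum>j\<in>?J - {?i1}. ereal (a j) * enn2ereal (Tr (p j)))
      = ereal (\<Sum>j\<in>?J - {?i1}. a j * (\<Sum>\<^sub>\<infinity>k. x j k))"
    by simp
  have "A - B - (\<Sum>j\<in>?J - {?i1}. ereal (a j) * enn2ereal (Tr (p j))) = ereal (real_of_int (essential_codim ?p q))"
    unfolding traces assms(13,14) index[symmetric] using ds(3) by (simp only: T)
  moreover have "Tr (p j) < \<infinity>" if "0 < j" "j < ?i1" for j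
    using Tr_fin[of j] sm[of j] that r by auto
  ultimately show ?thesis using fredholm by blast
qed

end
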